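(* Let $\Sigma\subset\mathbb{H}$ be a smooth embedded surface in the Heisenberg group $\mathbb{H}$, let $p$ be an isolated mildly degenerate characteristic point of $\Sigma$, and let $u\in C^\infty$ be a local defining function for $\Sigma$ in a neighborhood of $p$. Denote by $W=\|\nabla u\|$ the norm of the horizontal gradient of $u$. Then $\frac1W$ is locally integrable on $\Sigma$ around $p$ with respect to the Riemannian induced measure $\sigma_{\mathrm{R}}$, i.e. there is a neighborhood $U$ of $p$ in $\mathbb{H}$ such that $$\int_{\Sigma\cap U}\frac1W\,d\sigma_{\mathrm{R}}<+\infty.$$ In particular, the horizontal mean curvature $\mathcal{H}$ of $\Sigma$ is locally integrable around $p$: there is a neighborhood $U$ of $p$ in $\mathbb{H}$ such that $\int_{\Sigma\cap U}|\mathcal{H}|\,d\sigma_{\mathrm{R}}<+\infty$.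
   Context: The Heisenberg group $\mathbb{H}$ is $\mathbb{R}^3$ with the distribution $\mathcal{D}=\ker\left(dz-\frac12(x\,dy-y\,dx)\right)$ and the metric $g$ on $\mathcal{D}$ for which $X=\partial_x-\frac y2\partial_z$, $Y=\partial_y+\frac x2\partial_z$ is an orthonormal frame. It is equipped with the Lebesgue measure $\mu$. Horizontal gradient: $\nabla f=(Xf)X+(Yf)Y$, with norm $\|\nabla f\|=\left((Xf)^2+(Yf)^2\right)^{1/2}$. The divergence $\mathrm{div}_\mu$ is with respect to Lebesgue measure. A local defining function for $\Sigma$ near $p\in\Sigma$ is a $C^\infty$ function $u$ on a neighborhood $U$ of $p$ with $\Sigma\cap U=\{u=0\}$ and $du\neq0$ on $\Sigma\cap U$. Characteristic points: $p\in\Sigma$ is characteristic if $\mathcal{D}_p\subseteq T_p\Sigma$, equivalently $Xu(p)=Yu(p)=0$. The set of characteristic points is $C(\Sigma)$ (closed, zero measure in $\Sigma$); $p$ is isolated if it is an isolated point of $C(\Sigma)$. Horizontal Hessian at $p\in C(\Sigma)$: the bilinear form on $\mathcal{D}_p$ given by $\mathrm{Hess}_{\mathrm{H}}(u)|_p(V,W)=\sum_{i,j=1}^2V^iW^jX_iX_ju(p)$, where $X_1=X$, $X_2=Y$, $V=\sum_i V^iX_i$, $W=\sum_j W^jX_j$. The point $p\in C(\Sigma)$ is degenerate if the determinant of the matrix $(X_iX_ju(p))_{i,j}$ is $0$ (independent of the choice of $u$). The frame $N,T$: if $p\in C(\Sigma)$ is degenerate, the matrix has rank exactly one, and there is a unit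 vector $N_p\in\mathcal{D}_p$, unique up to sign, in the kernel of the Hessian, meaning $\mathrm{Hess}_{\mathrm{H}}(u)|_p(N_p,V)=0$ for all $V\in\mathcal{D}_p$. Write $N_p=aX_p+bY_p$ with $a^2+b^2=1$ and extend it to the left-invariant vector field $N=aX+bY$ ($a,b$ constant); set $T=-bX+aY$. Critical curve of $p$: $\mathcal{C}=\{q\in\Sigma : N(q)\in T_q\Sigma\}$. In a neighborhood of $p$ it is a smooth curve in $\Sigma$ through $p$. Mildly degenerate: a degenerate characteristic point $p$ is mildly degenerate if, for a regular parametrization $\gamma:(-\varepsilon,\varepsilon)\to\mathcal{C}$ of $\mathcal{C}$ near $p$ with $\gamma(0)=p$ and a local defining function $u$ near $p$, the function $s\mapsto Tu(\gamma(s))$ has a zero of finite order at $s=0$ (i.e. some derivative at $0$ is non-zero). This does not depend on the choices of $u$ and $\gamma$. Horizontal mean curvature: for $q\in\Sigma\setminus C(\Sigma)$, $\mathcal{H}(q)=-\mathrm{div}_\mu\left(\frac{\nabla u}{\|\nabla u\|}\right)\big|_q$ with $u$ a local defining function for $\Sigma$ near $q$; up to sign it does not depend on $u$. Riemannian induced measure: choose any Riemannian metric on $\mathbb{R}^3$ extending $g$, and let $n$ be the corresponding unit normal to $\Sigma$; $\sigma_{\mathrm{R}}$ is the measure on $\Sigma$ with density $|i_n\mu|$. The choice of extension plays no role in the integrability statement. *)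

theory Defs
  imports "HOL-Analysis.Analysis"
begin

text \<open>The library has no \<open>C\<^sup>\<infinity>\<close> predicate. On an open set, a map is \<open>C\<^sup>k\<^sup>+\<^sup>1\<close> iff it is
  differentiable and all its directional derivatives are \<open>C\<^sup>k\<close>.\<close>

fun Ck_on :: "nat \<Rightarrow> ('a::euclidean_space \<Rightarrow> 'b::real_normed_vector) \<Rightarrow> 'a set \<Rightarrow> bool" where
  "Ck_on 0 f U \<longleftrightarrow> continuous_on U f"
| "Ck_on (Suc k) f U \<longleftrightarrow>
     (\<forall>x\<in>U. f differentiable (at x)) \<and> (\<forall>v. Ck_on k (\<lambda>x. frechet_derivative f (at x) v) U)"

definition smooth_on :: "'a::euclidean_space set \<Rightarrow> ('a \<Rightarrow> 'b::real_normed_vector) \<Rightarrow> bool" where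
  "smooth_on U f \<longleftrightarrow> open U \<and> (\<forall>k. Ck_on k f U)"


section \<open>The Heisenberg group\<close>

type_synonym vfield = "real^3 \<Rightarrow> real^3"

definition heis_X :: vfield where
  "heis_X q = vector [1, 0, - (q$2) / 2]"

definition heis_Y :: vfield where
  "heis_Y q = vector [0, 1, (q$1) / 2]"

definition contact_form :: "real^3 \<Rightarrow> real^3 \<Rightarrow> real" where
  "contact_form q v = v$3 - (q$1 * v$2 - q$2 * v$1) / 2"

definition distribution :: "real^3 \<Rightarrow> (real^3) set" where
  "distribution q = {v. contact_form q v = 0}"

definition vf_deriv :: "vfield \<Rightarrow> (real^3 \<Rightarrow> real) \<Rightarrow> real^3 \<Rightarrow> real" where
  "vf_deriv V f q = frechet_derivative f (at q) (V q)"

definition hor_grad :: "(real^3 \<Rightarrow> real) \<Rightarrow> vfield" where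
  "hor_grad f q = vf_deriv heis_X f q *\<^sub>R heis_X q + vf_deriv heis_Y f q *\<^sub>R heis_Y q"

text \<open>The norm is that of the sub-Riemannian metric, for which \<open>X, Y\<close> are orthonormal, and not the
  Euclidean norm of \<open>\<real>\<^sup>3\<close>.\<close>

definition hor_grad_norm :: "(real^3 \<Rightarrow> real) \<Rightarrow> real^3 \<Rightarrow> real" where
  "hor_grad_norm f q = sqrt ((vf_deriv heis_X f q)\<^sup>2 + (vf_deriv heis_Y f q)\<^sup>2)"

definition divergence :: "vfield \<Rightarrow> real^3 \<Rightarrow> real" where
  "divergence F q = (\<Sum>i\<in>UNIV. frechet_derivative F (at q) (axis i 1) $ i)"


section \<open>Surfaces and characteristic points\<close>

definition local_defining_function ::
    "(real^3) set \<Rightarrow> real^3 \<Rightarrow> (real^3) set \<Rightarrow> (real^3 \<Rightarrow> real) \<Rightarrow> bool" where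
  "local_defining_function \<Sigma> p U u \<longleftrightarrow>
     open U \<and> p \<in> \<Sigma> \<inter> U \<and> smooth_on U u \<and> \<Sigma> \<inter> U = {q\<in>U. u q = 0} \<and>
     (\<forall>q\<in>\<Sigma> \<inter> U. frechet_derivative u (at q) \<noteq> (\<lambda>v. 0))"

definition embedded_surface :: "(real^3) set \<Rightarrow> bool" where
  "embedded_surface \<Sigma> \<longleftrightarrow> (\<forall>p\<in>\<Sigma>. \<exists>U u. local_defining_function \<Sigma> p U u)"

definition tangent_plane :: "(real^3) set \<Rightarrow> real^3 \<Rightarrow> (real^3) set" where
  "tangent_plane \<Sigma> q =
     {v. \<exists>U u. local_defining_function \<Sigma> q U u \<and> frechet_derivative u (at q) v = 0}"

definition characteristic_set :: "(real^3) set \<Rightarrow> (real^3) set" where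
  "characteristic_set \<Sigma> = {p\<in>\<Sigma>. distribution p \<subseteq> tangent_plane \<Sigma> p}"

definition heis_frame :: "2 \<Rightarrow> vfield" where
  "heis_frame i = (if i = 1 then heis_X else heis_Y)"

text \<open>The matrix \<open>(X\<^sub>i X\<^sub>j u)\<close>; it is not symmetric in general, since \<open>[X, Y] = \<partial>\<^sub>z\<close>.\<close>

definition hor_Hess_matrix :: "(real^3 \<Rightarrow> real) \<Rightarrow> real^3 \<Rightarrow> real^2^2" where
  "hor_Hess_matrix u p = (\<chi> i j. vf_deriv (heis_frame i) (vf_deriv (heis_frame j) u) p)"

text \<open>Horizontal vectors are given by their coordinates in the frame \<open>X, Y\<close>.\<close>

definition hor_Hess :: "(real^3 \<Rightarrow> real) \<Rightarrow> real^3 \<Rightarrow> real^2 \<Rightarrow> real^2 \<Rightarrow> real" where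
  "hor_Hess u p V W = (\<Sum>i\<in>UNIV. \<Sum>j\<in>UNIV. V$i * W$j * hor_Hess_matrix u p $ i $ j)"

definition degenerate :: "(real^3) set \<Rightarrow> real^3 \<Rightarrow> bool" where
  "degenerate \<Sigma> p \<longleftrightarrow> p \<in> characteristic_set \<Sigma> \<and>
     (\<exists>U u. local_defining_function \<Sigma> p U u \<and> det (hor_Hess_matrix u p) = 0)"

definition field_N :: "real^2 \<Rightarrow> vfield" where
  "field_N n q = n$1 *\<^sub>R heis_X q + n$2 *\<^sub>R heis_Y q"

definition field_T :: "real^2 \<Rightarrow> vfield" where
  "field_T n q = - (n$2) *\<^sub>R heis_X q + n$1 *\<^sub>R heis_Y q"

definition critical_curve :: "(real^3) set \<Rightarrow> real^2 \<Rightarrow> (real^3) set" where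
  "critical_curve \<Sigma> n = {q\<in>\<Sigma>. field_N n q \<in> tangent_plane \<Sigma> q}"

definition regular_parametrization_near ::
    "(real^3) set \<Rightarrow> real^3 \<Rightarrow> real \<Rightarrow> (real \<Rightarrow> real^3) \<Rightarrow> bool" where
  "regular_parametrization_near C p \<epsilon> \<gamma> \<longleftrightarrow>
     \<epsilon> > 0 \<and> \<gamma> 0 = p \<and> smooth_on {-\<epsilon><..<\<epsilon>} \<gamma> \<and> inj_on \<gamma> {-\<epsilon><..<\<epsilon>} \<and>
     (\<forall>s\<in>{-\<epsilon><..<\<epsilon>}. vector_derivative \<gamma> (at s) \<noteq> 0) \<and>
     (\<exists>B. open B \<and> p \<in> B \<and> \<gamma> ` {-\<epsilon><..<\<epsilon>} = C \<inter> B)"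

text \<open>The notion does not depend on \<open>u\<close>, \<open>\<gamma>\<close> or the sign of \<open>n\<close>, so one choice is asked for.\<close>

definition mildly_degenerate :: "(real^3) set \<Rightarrow> real^3 \<Rightarrow> bool" where
  "mildly_degenerate \<Sigma> p \<longleftrightarrow> degenerate \<Sigma> p \<and>
     (\<exists>U u n \<epsilon> \<gamma>. local_defining_function \<Sigma> p U u \<and>
        norm n = 1 \<and> (\<forall>V. hor_Hess u p n V = 0) \<and>
        regular_parametrization_near (critical_curve \<Sigma> n) p \<epsilon> \<gamma> \<and>
        (\<exists>k. (deriv ^^ k) (\<lambda>s. vf_deriv (field_T n) u (\<gamma> s)) 0 \<noteq> 0))"

text \<open>At non-characteristic points of \<open>\<Sigma> \<inter> U\<close>, where \<open>u\<close> is a local defining function on \<open>U\<close>.\<close>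

definition hor_mean_curvature :: "(real^3 \<Rightarrow> real) \<Rightarrow> real^3 \<Rightarrow> real" where
  "hor_mean_curvature u q = - divergence (\<lambda>x. hor_grad u x /\<^sub>R hor_grad_norm u x) q"


section \<open>The Riemannian induced measure\<close>

definition riemannian_metric :: "(real^3 \<Rightarrow> real^3 \<Rightarrow> real^3 \<Rightarrow> real) \<Rightarrow> bool" where
  "riemannian_metric G \<longleftrightarrow>
     (\<forall>q. bilinear (G q) \<and> (\<forall>v w. G q v w = G q w v) \<and> (\<forall>v. v \<noteq> 0 \<longrightarrow> G q v v > 0)) \<and>
     (\<forall>v w. smooth_on UNIV (\<lambda>q. G q v w))"

text \<open>The sub-Riemannian metric is the one making \<open>X, Y\<close> orthonormal on their span, which is the
  distribution; so \<open>G\<close> extends it iff \<open>X, Y\<close> are \<open>G\<close>-orthonormal.\<close>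

definition extends_heis_metric :: "(real^3 \<Rightarrow> real^3 \<Rightarrow> real^3 \<Rightarrow> real) \<Rightarrow> bool" where
  "extends_heis_metric G \<longleftrightarrow>
     (\<forall>q. G q (heis_X q) (heis_X q) = 1 \<and> G q (heis_Y q) (heis_Y q) = 1 \<and>
          G q (heis_X q) (heis_Y q) = 0)"

text \<open>Unique up to sign; only \<open>\<bar>i\<^sub>n \<mu>\<bar>\<close> is used below.\<close>

definition unit_normal ::
    "(real^3 \<Rightarrow> real^3 \<Rightarrow> real^3 \<Rightarrow> real) \<Rightarrow> (real^3) set \<Rightarrow> real^3 \<Rightarrow> real^3" where
  "unit_normal G \<Sigma> q =
     (SOME n. G q n n = 1 \<and> (\<forall>v\<in>tangent_plane \<Sigma> q. G q n v = 0))"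

text \<open>\<open>\<bar>i\<^sub>n \<mu>(v, w)\<bar> = \<bar>\<mu>(n, v, w)\<bar>\<close>, where \<open>\<mu> = dx \<and> dy \<and> dz\<close> is the Lebesgue volume, and not the
  volume form of \<open>G\<close>.\<close>

definition induced_density ::
    "(real^3 \<Rightarrow> real^3 \<Rightarrow> real^3 \<Rightarrow> real) \<Rightarrow> (real^3) set \<Rightarrow> real^3 \<Rightarrow> real^3 \<Rightarrow> real^3 \<Rightarrow> real" where
  "induced_density G \<Sigma> q v w = \<bar>det (vector [unit_normal G \<Sigma> q, v, w] :: real^3^3)\<bar>"

definition surface_chart :: "(real^3) set \<Rightarrow> (real^2) set \<Rightarrow> (real^2 \<Rightarrow> real^3) \<Rightarrow> bool" where
  "surface_chart \<Sigma> D \<phi> \<longleftrightarrow>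
     open D \<and> smooth_on D \<phi> \<and> inj_on \<phi> D \<and> \<phi> ` D \<subseteq> \<Sigma> \<and>
     (\<forall>s\<in>D. inj (frechet_derivative \<phi> (at s)))"

text \<open>The measure on \<open>\<Sigma>\<close> with density \<open>\<bar>i\<^sub>n \<mu>\<bar>\<close>, i.e. the Borel measure that every local
  parametrization \<open>\<phi>\<close> pulls back to \<open>\<bar>i\<^sub>n \<mu>(\<partial>\<^sub>1\<phi>, \<partial>\<^sub>2\<phi>)\<bar> ds\<close>. On an embedded surface it exists, by
  change of variables between charts, and it is unique, because countably many charts cover \<open>\<Sigma>\<close>.\<close>

definition riemannian_induced_measure ::
    "(real^3 \<Rightarrow> real^3 \<Rightarrow> real^3 \<Rightarrow> real) \<Rightarrow> (real^3) set \<Rightarrow> (real^3) measure \<Rightarrow> bool" where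
  "riemannian_induced_measure G \<Sigma> \<sigma> \<longleftrightarrow>
     space \<sigma> = \<Sigma> \<and> sets \<sigma> = sets (restrict_space borel \<Sigma>) \<and>
     (\<forall>D \<phi> A. surface_chart \<Sigma> D \<phi> \<longrightarrow> A \<in> sets \<sigma> \<longrightarrow> A \<subseteq> \<phi> ` D \<longrightarrow>
        emeasure \<sigma> A =
          (\<integral>\<^sup>+s\<in>{s\<in>D. \<phi> s \<in> A}.
             ennreal (induced_density G \<Sigma> (\<phi> s)
               (frechet_derivative \<phi> (at s) (axis 1 1)) (frechet_derivative \<phi> (at s) (axis 2 1)))
           \<partial>lborel))"

end

theory Submission
  imports Defs
begin

text \<open>Let \<open>F = Nu\<close> and \<open>E = Tu\<close>, so that \<open>W\<^sup>2 = F\<^sup>2 + E\<^sup>2\<close>. At \<open>p\<close> one has \<open>NTu = 0\<close> and hence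
  \<open>TF = NTu - [N, T]u = - \<partial>\<^sub>zu \<noteq> 0\<close>, so \<open>\<Psi> = (n\<^sub>1x + n\<^sub>2y, Nu, u)\<close> is a local diffeomorphism that maps
  \<open>\<Sigma>\<close> to a plane and the critical curve to an axis \<open>t = 0\<close> of this plane. In the coordinates \<open>(s, t)\<close>
  we have \<open>W \<ge> \<bar>F\<bar> = \<bar>t\<bar>\<close>, and since \<open>E\<close> vanishes to finite order along the curve and is
  Lipschitz in \<open>t\<close>, also \<open>W \<ge> c\<bar>s\<bar>\<^sup>j\<close>. Interpolating, \<open>1/W\<close> is bounded by a multiple of
  \<open>\<bar>s\<bar>\<^sup>-\<^sup>\<alpha>\<bar>t\<bar>\<^sup>-\<^sup>\<alpha>\<close> with \<open>\<alpha> = j/(j + 1) < 1\<close>, a product of integrable functions. The mean curvature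
  is \<open>O(1/W)\<close>.\<close>

section \<open>Smooth maps\<close>

text \<open>The horizontal Hessian is not symmetric, and this asymmetry makes the straightening
  possible: the kernel condition puts \<open>n\<close> in the first slot, so every N(Vu) vanishes at
  p, whereas T(Nu) survives as a commutator. Hence {u = 0} and {Nu = 0} are transversal at p
  although du annihilates both N and T there. The order of vanishing is known along the given
  parametrization only and has to be transferred to the coordinate s; this works because the
  velocity of the curve is mapped to a nonzero multiple of the first axis. Neither lower bound for W
  suffices alone: 1/\<bar>t\<bar> is not integrable, nor is \<bar>s\<bar>^(-j) for j \<ge> 1.
  Splitting W as W^(1/(j+1)) W^(j/(j+1)), with the s-bound in the first factor and the t-bound in
  the second, gives the same exponent j/(j+1) in both variables. Mild degeneracy is witnessed by
  some defining function, so the estimate is proved for that one and carried over to the given u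
  through the proportionality of the differentials along \<Sigma>.\<close>

lemma frechet_derivative_eqI: "(f has_derivative f') (at x) \<Longrightarrow> frechet_derivative f (at x) = f'"
  by (rule frechet_derivative_at[symmetric])

lemma frechet_derivative_cong_open:
  assumes "open U" "x \<in> U" "\<And>y. y \<in> U \<Longrightarrow> f y = g y" "f differentiable (at x)"
  shows "g differentiable (at x)" "frechet_derivative g (at x) = frechet_derivative f (at x)"
proof -
  have "(g has_derivative frechet_derivative f (at x)) (at x)"
    using assms frechet_derivative_works has_derivative_transform_within_open by metis
  then show "g differentiable (at x)" "frechet_derivative g (at x) = frechet_derivative f (at x)"
    by (auto simp: differentiable_def frechet_derivative_eqI)
qed

text \<open>Openness matters because \<open>frechet_derivative\<close> looks at a full neighbourhood
  of the point. The closure lemmas below compute a formula for the derivative on \<open>U\<close>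
  only and substitute it through this lemma.\<close>

lemma Ck_on_cong_imp:
  assumes "open U" "\<And>x. x \<in> U \<Longrightarrow> f x = g x" "Ck_on k f U"
  shows "Ck_on k g U"
  using assms(2,3)
proof (induction k arbitrary: f g)
  case 0
  then show ?case using continuous_on_cong by fastforce
next
  case (Suc k)
  have d: "g differentiable (at x)" "frechet_derivative g (at x) = frechet_derivative f (at x)"
    if "x \<in> U" for x
    using frechet_derivative_cong_open[of U x f g] assms(1) that Suc.prems by auto
  have "Ck_on k (\<lambda>x. frechet_derivative g (at x) v) U" for v
    by (rule Suc.IH[of "\<lambda>x. frechet_derivative f (at x) v"]) (use Suc.prems d in auto)
  with d show ?case by simp
qed

lemma Ck_on_subset: "Ck_on k f U \<Longrightarrow> V \<subseteq> U \<Longrightarrow> Ck_on k f V"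
  by (induction k arbitrary: f) (auto intro: continuous_on_subset)

text \<open>In the Leibniz rule a factor occurs undifferentiated beside a derivative, so inductions
  on the order need the factor itself one order lower. At the bottom this is continuity of
  differentiable maps.\<close>

lemma Ck_on_SucD: "Ck_on (Suc k) f U \<Longrightarrow> Ck_on k f U"
proof (induction k arbitrary: f)
  case 0
  then have "\<forall>x\<in>U. f differentiable (at x)" by simp
  then show ?case
    by (simp add: continuous_at_imp_continuous_on differentiable_imp_continuous_within)
next
  case (Suc k)
  have "Ck_on k (\<lambda>x. frechet_derivative f (at x) v) U" for v
    by (rule Suc.IH) (use Suc.prems Ck_on.simps(2)[of "Suc k" f U] in blast)
  moreover have "\<forall>x\<in>U. f differentiable (at x)"
    using Suc.prems Ck_on.simps(2)[of "Suc k" f U] by blast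
  ultimately show ?case by (simp only: Ck_on.simps) blast
qed

lemma Ck_on_Suc_has_derivative:
  "Ck_on (Suc k) f U \<Longrightarrow> x \<in> U \<Longrightarrow> (f has_derivative frechet_derivative f (at x)) (at x)"
  using frechet_derivative_works by auto

lemma Ck_on_Suc_frechet:
  "Ck_on (Suc k) f U \<Longrightarrow> Ck_on k (\<lambda>x. frechet_derivative f (at x) v) U"
  by simp

lemma Ck_on_const [simp]: "Ck_on k (\<lambda>x. c) U"
  by (induction k arbitrary: c) auto

section \<open>Closure of C^k maps under algebraic operations and composition\<close>

lemma Ck_on_bounded_linear_compose:
  assumes "bounded_linear L" "open U" "Ck_on k f U"
  shows "Ck_on k (\<lambda>x. L (f x)) U"
  using assms(3)
proof (induction k arbitrary: f)
  case 0
  then show ?case using assms(1) by (auto intro: bounded_linear.continuous_on)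
next
  case (Suc k)
  have d: "((\<lambda>x. L (f x)) has_derivative (\<lambda>v. L (frechet_derivative f (at x) v))) (at x)"
    if "x \<in> U" for x
    by (intro bounded_linear.has_derivative[OF assms(1)] Ck_on_Suc_has_derivative[OF Suc.prems that])
  have "Ck_on k (\<lambda>x. frechet_derivative (\<lambda>x. L (f x)) (at x) v) U" for v
    by (rule Ck_on_cong_imp[OF assms(2) _ Suc.IH[of "\<lambda>x. frechet_derivative f (at x) v"]])
      (use Suc.prems frechet_derivative_eqI[OF d] in auto)
  with d show ?case unfolding Ck_on.simps differentiable_def by blast
qed

lemma Ck_on_linear:
  assumes "bounded_linear L" shows "Ck_on k L U"
proof (cases k)
  case 0
  then show ?thesis using assms by (simp add: linear_continuous_on)
next
  case (Suc m)
  have "frechet_derivative L (at x) = L" for x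
    using assms by (intro frechet_derivative_eqI bounded_linear_imp_has_derivative)
  then show ?thesis using assms Suc bounded_linear_imp_differentiable by auto
qed

lemma Ck_on_add:
  assumes "open U" "Ck_on k f U" "Ck_on k g U"
  shows "Ck_on k (\<lambda>x. f x + g x) U"
  using assms(2,3)
proof (induction k arbitrary: f g)
  case 0
  then show ?case by (auto intro: continuous_intros)
next
  case (Suc k)
  let ?D = "\<lambda>f x v. frechet_derivative f (at x) v"
  have d: "((\<lambda>x. f x + g x) has_derivative (\<lambda>v. ?D f x v + ?D g x v)) (at x)" if "x \<in> U" for x
    by (intro has_derivative_add Ck_on_Suc_has_derivative[OF _ that]) (use Suc.prems in blast)+
  have "Ck_on k (\<lambda>x. ?D (\<lambda>x. f x + g x) x v) U" for v
    by (rule Ck_on_cong_imp[OF assms(1) _ Suc.IH[of "\<lambda>x. ?D f x v" "\<lambda>x. ?D g x v"]])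
      (use Suc.prems frechet_derivative_eqI[OF d] in auto)
  with d show ?case unfolding Ck_on.simps differentiable_def by blast
qed

lemma Ck_on_scaleR:
  assumes "open U" "Ck_on k f U" "Ck_on k g U"
  shows "Ck_on k (\<lambda>x. f x *\<^sub>R g x) U"
  using assms(2,3)
proof (induction k arbitrary: f g)
  case 0
  then show ?case by (auto intro: continuous_intros)
next
  case (Suc k)
  let ?D = "\<lambda>f x v. frechet_derivative f (at x) v"
  have d: "((\<lambda>x. f x *\<^sub>R g x) has_derivative (\<lambda>v. f x *\<^sub>R ?D g x v + ?D f x v *\<^sub>R g x)) (at x)"
    if "x \<in> U" for x
    by (intro has_derivative_scaleR Ck_on_Suc_has_derivative[OF _ that]) (use Suc.prems in blast)+
  have "Ck_on k (\<lambda>x. ?D (\<lambda>x. f x *\<^sub>R g x) x v) U" for v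
  proof (rule Ck_on_cong_imp[OF assms(1)])
    show "Ck_on k (\<lambda>x. f x *\<^sub>R ?D g x v + ?D f x v *\<^sub>R g x) U"
      by (intro Ck_on_add assms(1) Suc.IH Ck_on_SucD[OF Suc.prems(1)] Ck_on_SucD[OF Suc.prems(2)]
          Ck_on_Suc_frechet Suc.prems)
  qed (use frechet_derivative_eqI[OF d] in auto)
  with d show ?case unfolding Ck_on.simps differentiable_def by blast
qed

lemma Ck_on_mult:
  fixes f g :: "'a::euclidean_space \<Rightarrow> real"
  shows "open U \<Longrightarrow> Ck_on k f U \<Longrightarrow> Ck_on k g U \<Longrightarrow> Ck_on k (\<lambda>x. f x * g x) U"
  using Ck_on_scaleR[of U k f g] by simp

lemma Ck_on_sum:
  assumes "open U" "\<And>i. i \<in> I \<Longrightarrow> Ck_on k (f i) U"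
  shows "Ck_on k (\<lambda>x. \<Sum>i\<in>I. f i x) U"
  using assms(2)
  by (induction I rule: infinite_finite_induct) (auto intro: Ck_on_add assms(1))

lemma Ck_on_prod:
  fixes f :: "'i \<Rightarrow> 'a::euclidean_space \<Rightarrow> real"
  assumes "open U" "\<And>i. i \<in> I \<Longrightarrow> Ck_on k (f i) U"
  shows "Ck_on k (\<lambda>x. \<Prod>i\<in>I. f i x) U"
  using assms(2)
  by (induction I rule: infinite_finite_induct) (auto intro: Ck_on_mult assms(1))

lemma Ck_on_inverse:
  fixes f :: "'a::euclidean_space \<Rightarrow> real"
  assumes "open U" "Ck_on k f U" "\<And>x. x \<in> U \<Longrightarrow> f x \<noteq> 0"
  shows "Ck_on k (\<lambda>x. inverse (f x)) U"
  using assms(2)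
proof (induction k)
  case 0
  then show ?case using assms(3) by (auto intro: continuous_intros)
next
  case (Suc k)
  let ?D = "\<lambda>f x v. frechet_derivative f (at x) v"
  have d: "((\<lambda>x. inverse (f x)) has_derivative (\<lambda>v. - (inverse (f x) * ?D f x v * inverse (f x)))) (at x)"
    if "x \<in> U" for x
    by (intro Deriv.has_derivative_inverse Ck_on_Suc_has_derivative[OF Suc.prems that] assms(3) that)
  have "Ck_on k (\<lambda>x. ?D (\<lambda>x. inverse (f x)) x v) U" for v
  proof (rule Ck_on_cong_imp[OF assms(1)])
    show "Ck_on k (\<lambda>x. (- 1) * (inverse (f x) * ?D f x v * inverse (f x))) U"
      by (intro Ck_on_mult assms(1) Ck_on_const Suc.IH Ck_on_SucD[OF Suc.prems]
          Ck_on_Suc_frechet Suc.prems)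
  qed (use frechet_derivative_eqI[OF d] in auto)
  with d show ?case unfolding Ck_on.simps differentiable_def by blast
qed

lemma Ck_on_divide:
  fixes f g :: "'a::euclidean_space \<Rightarrow> real"
  shows "open U \<Longrightarrow> Ck_on k f U \<Longrightarrow> Ck_on k g U \<Longrightarrow> (\<And>x. x \<in> U \<Longrightarrow> g x \<noteq> 0) \<Longrightarrow>
    Ck_on k (\<lambda>x. f x / g x) U"
  unfolding divide_inverse by (intro Ck_on_mult Ck_on_inverse)

lemma Ck_on_componentwise:
  fixes f :: "'a::euclidean_space \<Rightarrow> 'b::euclidean_space"
  assumes "open U" "\<And>b. b \<in> Basis \<Longrightarrow> Ck_on k (\<lambda>x. f x \<bullet> b) U"
  shows "Ck_on k f U"
proof (rule Ck_on_cong_imp[OF assms(1)])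
  show "Ck_on k (\<lambda>x. \<Sum>b\<in>Basis. (f x \<bullet> b) *\<^sub>R b) U"
    by (intro Ck_on_sum Ck_on_scaleR Ck_on_const assms)
qed (rule euclidean_representation)

lemma Ck_on_vec:
  fixes f :: "'a::euclidean_space \<Rightarrow> real^'n"
  assumes "open U" "\<And>i. Ck_on k (\<lambda>x. f x $ i) U"
  shows "Ck_on k f U"
  by (rule Ck_on_componentwise[OF assms(1)]) (use assms(2) in \<open>auto simp: Basis_vec_def inner_axis\<close>)

lemma Ck_on_vec_nth:
  "open U \<Longrightarrow> Ck_on k f U \<Longrightarrow> Ck_on k (\<lambda>x. f x $ i) U"
  by (rule Ck_on_bounded_linear_compose[OF bounded_linear_vec_nth])

lemma frechet_derivative_Basis_expansion:
  fixes f :: "'a::euclidean_space \<Rightarrow> 'b::real_normed_vector"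
  assumes "f differentiable (at x)"
  shows "frechet_derivative f (at x) v = (\<Sum>b\<in>Basis. (v \<bullet> b) *\<^sub>R frechet_derivative f (at x) b)"
proof -
  have l: "linear (frechet_derivative f (at x))"
    using assms linear_frechet_derivative by blast
  have "frechet_derivative f (at x) (\<Sum>b\<in>Basis. (v \<bullet> b) *\<^sub>R b)
      = (\<Sum>b\<in>Basis. (v \<bullet> b) *\<^sub>R frechet_derivative f (at x) b)"
    by (simp add: linear_sum[OF l] linear_cmul[OF l])
  then show ?thesis by (simp add: euclidean_representation)
qed

text \<open>The derivative Df(g x)(Dg x v) has a direction that moves with x, while
  \<open>Ck_on\<close> speaks of fixed directions. Expanding the direction in the standard basis
  turns it into a sum of products to which the induction hypothesis applies.\<close>

lemma Ck_on_compose: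
  fixes f :: "'b::euclidean_space \<Rightarrow> 'c::real_normed_vector" and g :: "'a::euclidean_space \<Rightarrow> 'b"
  assumes "open U" "Ck_on k f V" "Ck_on k g U" "g ` U \<subseteq> V"
  shows "Ck_on k (\<lambda>x. f (g x)) U"
  using assms(2,3)
proof (induction k arbitrary: f)
  case 0
  then show ?case using assms(4) by (auto intro: continuous_on_compose2)
next
  case (Suc k)
  let ?D = "\<lambda>f x v. frechet_derivative f (at x) v"
  have d: "((\<lambda>x. f (g x)) has_derivative (\<lambda>v. ?D f (g x) (?D g x v))) (at x)" if "x \<in> U" for x
  proof -
    have "g x \<in> V" using that assms(4) by blast
    then show ?thesis
      using diff_chain_at[OF Ck_on_Suc_has_derivative[OF Suc.prems(2) that]
          Ck_on_Suc_has_derivative[OF Suc.prems(1)]] by (simp only: o_def)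
  qed
  have "Ck_on k (\<lambda>x. ?D (\<lambda>x. f (g x)) x v) U" for v
  proof (rule Ck_on_cong_imp[OF assms(1)])
    show "Ck_on k (\<lambda>x. \<Sum>b\<in>Basis. (?D g x v \<bullet> b) *\<^sub>R ?D f (g x) b) U"
    proof (rule Ck_on_sum[OF assms(1) Ck_on_scaleR[OF assms(1)]])
      fix b :: 'b
      show "Ck_on k (\<lambda>x. ?D g x v \<bullet> b) U"
        by (rule Ck_on_bounded_linear_compose[OF bounded_linear_inner_left assms(1)
              Ck_on_Suc_frechet[OF Suc.prems(2)]])
      show "Ck_on k (\<lambda>x. ?D f (g x) b) U"
        by (rule Suc.IH[OF Ck_on_Suc_frechet[OF Suc.prems(1)] Ck_on_SucD[OF Suc.prems(2)]])
    qed
    show "(\<Sum>b\<in>Basis. (?D g x v \<bullet> b) *\<^sub>R ?D f (g x) b) = ?D (\<lambda>x. f (g x)) x v" if "x \<in> U" for x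
    proof -
      have "f differentiable (at (g x))" using that assms(4) Suc.prems by auto
      then show ?thesis
        using frechet_derivative_Basis_expansion[of f "g x" "?D g x v"]
          frechet_derivative_eqI[OF d[OF that]] by auto
    qed
  qed
  with d show ?case unfolding Ck_on.simps differentiable_def by blast
qed

section \<open>Maps of class C^\<infinity>\<close>

lemma smooth_on_differentiable: "smooth_on U f \<Longrightarrow> x \<in> U \<Longrightarrow> f differentiable (at x)"
  using Ck_on.simps(2)[of 0 f U] by (auto simp: smooth_on_def simp del: Ck_on.simps)

lemma smooth_on_has_derivative:
  "smooth_on U f \<Longrightarrow> x \<in> U \<Longrightarrow> (f has_derivative frechet_derivative f (at x)) (at x)"
  using smooth_on_differentiable frechet_derivative_works by blast

lemma smooth_on_continuous_on: "smooth_on U f \<Longrightarrow> continuous_on U f"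
  using Ck_on.simps(1) by (auto simp: smooth_on_def simp del: Ck_on.simps)

lemma smooth_on_subset: "smooth_on U f \<Longrightarrow> V \<subseteq> U \<Longrightarrow> open V \<Longrightarrow> smooth_on V f"
  by (auto simp: smooth_on_def intro: Ck_on_subset)

lemma smooth_on_frechet_derivative:
  "smooth_on U f \<Longrightarrow> smooth_on U (\<lambda>x. frechet_derivative f (at x) v)"
  by (auto simp: smooth_on_def intro: Ck_on_Suc_frechet)

lemma smooth_on_const: "open U \<Longrightarrow> smooth_on U (\<lambda>x. c)"
  by (simp add: smooth_on_def)

lemma smooth_on_linear: "open U \<Longrightarrow> bounded_linear L \<Longrightarrow> smooth_on U L"
  by (simp add: smooth_on_def Ck_on_linear)

lemma smooth_on_add: "smooth_on U f \<Longrightarrow> smooth_on U g \<Longrightarrow> smooth_on U (\<lambda>x. f x + g x)"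
  by (simp add: smooth_on_def Ck_on_add)

lemma smooth_on_mult:
  fixes f g :: "'a::euclidean_space \<Rightarrow> real"
  shows "smooth_on U f \<Longrightarrow> smooth_on U g \<Longrightarrow> smooth_on U (\<lambda>x. f x * g x)"
  by (simp add: smooth_on_def Ck_on_mult)

lemma smooth_on_vec:
  fixes f :: "'a::euclidean_space \<Rightarrow> real^'n"
  shows "open U \<Longrightarrow> (\<And>i. smooth_on U (\<lambda>x. f x $ i)) \<Longrightarrow> smooth_on U f"
  by (simp add: smooth_on_def Ck_on_vec)

lemma smooth_on_compose:
  fixes f :: "'b::euclidean_space \<Rightarrow> 'c::real_normed_vector"
  assumes "smooth_on V f" "smooth_on U g" "g ` U \<subseteq> V"
  shows "smooth_on U (\<lambda>x. f (g x))"
  unfolding smooth_on_def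
proof (intro conjI allI)
  show "open U" using assms(2) by (simp add: smooth_on_def)
  show "Ck_on k (\<lambda>x. f (g x)) U" for k
  proof (rule Ck_on_compose[OF \<open>open U\<close> _ _ assms(3)])
    show "Ck_on k f V" "Ck_on k g U" using assms(1,2) unfolding smooth_on_def by blast+
  qed
qed

text \<open>\<open>inverse_function_theorem\<close> gives a differentiable inverse g, and smoothness
  is bootstrapped: by Cramer's rule Dg(y) v is a rational expression in the entries of Df(g(y)) with
  nonvanishing denominator, so if g is C^k then Dg is C^k and g is C^(k+1).\<close>

theorem smooth_inverse_function:
  fixes f :: "real^'n \<Rightarrow> real^'n"
  assumes f: "smooth_on U f" and x0: "x0 \<in> U" and inj: "inj (frechet_derivative f (at x0))"
  obtains U' V g where "open U'" "U' \<subseteq> U" "x0 \<in> U'" "open V" "f x0 \<in> V"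
    "homeomorphism U' V f g" "smooth_on V g"
proof -
  let ?D = "\<lambda>x. frechet_derivative f (at x)"
  define f' where "f' x = Blinfun (?D x)" for x
  have U: "open U" using f by (simp add: smooth_on_def)
  have bl: "bounded_linear (?D x)" if "x \<in> U" for x
    using smooth_on_has_derivative[OF f that] by (rule has_derivative_bounded_linear)
  have f': "blinfun_apply (f' x) = ?D x" if "x \<in> U" for x
    unfolding f'_def using bl[OF that] by (rule bounded_linear_Blinfun_apply)
  have c: "continuous_on U f'"
  proof (rule continuous_on_blinfun_componentwise)
    fix b :: "real^'n"
    show "continuous_on U (\<lambda>x. blinfun_apply (f' x) b)"
      using smooth_on_continuous_on[OF smooth_on_frechet_derivative[OF f, of b]]
      by (rule continuous_on_eq) (simp add: f')
  qed
  have lin0: "linear (?D x0)" using bl[OF x0] bounded_linear.linear by blast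
  obtain h where h: "linear h" "h \<circ> ?D x0 = id"
    using linear_injective_left_inverse[OF lin0 inj] by blast
  have blh: "bounded_linear h" using h(1) linear_conv_bounded_linear by blast
  have inv: "Blinfun h o\<^sub>L f' x0 = id_blinfun"
    by (rule blinfun_eqI) (use h(2) in \<open>simp add: f' x0 bounded_linear_Blinfun_apply[OF blh] fun_eq_iff\<close>)
  obtain U' V g g' where *: "open U'" "U' \<subseteq> U" "x0 \<in> U'" "open V" "f x0 \<in> V" "homeomorphism U' V f g"
    and g': "\<And>y. y \<in> V \<Longrightarrow> (g has_derivative (g' y)) (at y)"
    and g'_inv: "\<And>y. y \<in> V \<Longrightarrow> g' y = inv (blinfun_apply (f'(g y)))"
    and bij: "\<And>y. y \<in> V \<Longrightarrow> bij (blinfun_apply (f'(g y)))"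
    using inverse_function_theorem[OF U _ c x0 inv] smooth_on_has_derivative[OF f]
    by (metis f')
  have gV: "g y \<in> U" if "y \<in> V" for y
    using *(2,6) that unfolding homeomorphism_def by blast
  define A where "A y = matrix (?D (g y))" for y
  have A: "A y *v w = ?D (g y) w" if "y \<in> V" for y w
    unfolding A_def using matrix_vector_mul(2)[of "?D (g y)"] bl[OF gV[OF that]] bounded_linear.linear
    by (metis matrix_works)
  have detA: "det (A y) \<noteq> 0" if "y \<in> V" for y
  proof -
    have "inj (?D (g y))" using bij[OF that] f'[OF gV[OF that]] by (simp add: bij_def)
    moreover have "linear (?D (g y))" using bl[OF gV[OF that]] bounded_linear.linear by blast
    ultimately show ?thesis unfolding A_def by (simp add: det_nz_iff_inj)
  qed
  have g'_eq: "g' y v = (\<chi> k. det (\<chi> i j. if j = k then v $ i else A y $ i $ j) / det (A y))"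
    if "y \<in> V" for y v
  proof -
    have "?D (g y) (g' y v) = v"
      using bij[OF that] f'[OF gV[OF that]] g'_inv[OF that] by (simp add: bij_def surj_f_inv_f)
    then have "A y *v g' y v = v" using A[OF that] by simp
    with cramer[OF detA[OF that]] show ?thesis by blast
  qed
  have "Ck_on k g V" for k
  proof (induction k)
    case 0
    then show ?case using *(6) by (simp add: homeomorphism_def)
  next
    case (Suc k)
    have A_ij: "Ck_on k (\<lambda>y. A y $ i $ j) V" for i j
    proof -
      have "Ck_on k (\<lambda>x. ?D x (axis j 1)) U"
        using smooth_on_frechet_derivative[OF f] by (simp add: smooth_on_def)
      then have "Ck_on k (\<lambda>y. ?D (g y) (axis j 1)) V"
        using Ck_on_compose[OF *(4) _ Suc] gV by blast
      then show ?thesis unfolding A_def matrix_def using Ck_on_vec_nth[OF *(4)] by simp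
    qed
    have "Ck_on k (\<lambda>y. frechet_derivative g (at y) v) V" for v
    proof (rule Ck_on_cong_imp[OF *(4)])
      show "Ck_on k (\<lambda>y. \<chi> k. det (\<chi> i j. if j = k then v $ i else A y $ i $ j) / det (A y)) V"
      proof (rule Ck_on_vec[OF *(4)])
        fix l
        have "Ck_on k (\<lambda>y. if j = l then v $ i else A y $ i $ j) V" for i j
          using A_ij by (cases "j = l") auto
        then show "Ck_on k (\<lambda>y. (\<chi> k. det (\<chi> i j. if j = k then v $ i else A y $ i $ j) / det (A y)) $ l) V"
          using detA A_ij *(4) unfolding det_def vec_lambda_beta
          by (intro Ck_on_divide Ck_on_sum Ck_on_mult Ck_on_prod Ck_on_const) auto
      qed
    qed (use g'_eq frechet_derivative_eqI[OF g'] in auto)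
    moreover have "\<forall>y\<in>V. g differentiable (at y)" using g' by (auto simp: differentiable_def)
    ultimately show ?case by simp
  qed
  then have "smooth_on V g" using *(4) by (simp add: smooth_on_def)
  with * show thesis using that by blast
qed

section \<open>Symmetry of second derivatives and tangent planes\<close>

abbreviation fd :: "('a::real_normed_vector \<Rightarrow> 'b::real_normed_vector) \<Rightarrow> 'a \<Rightarrow> 'a \<Rightarrow> 'b"
  where "fd f x \<equiv> frechet_derivative f (at x)"

lemma smooth_on_linear_fd: "smooth_on U f \<Longrightarrow> x \<in> U \<Longrightarrow> linear (fd f x)"
  using smooth_on_differentiable linear_frechet_derivative by blast

section \<open>Equality of mixed second derivatives\<close>

lemma smooth_on_line_has_derivative:
  fixes u :: "'a::euclidean_space \<Rightarrow> real"
  assumes "smooth_on U u" "x + s *\<^sub>R v \<in> U"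
  shows "((\<lambda>s. u (x + s *\<^sub>R v)) has_real_derivative fd u (x + s *\<^sub>R v) v) (at s)"
proof -
  have l: "linear (fd u (x + s *\<^sub>R v))" using assms smooth_on_linear_fd by blast
  have "((\<lambda>s. x + s *\<^sub>R v) has_derivative (\<lambda>t. t *\<^sub>R v)) (at s)"
    by (auto intro!: derivative_eq_intros)
  from diff_chain_at[OF this smooth_on_has_derivative[OF assms]]
  have "((\<lambda>s. u (x + s *\<^sub>R v)) has_derivative (\<lambda>t. fd u (x + s *\<^sub>R v) (t *\<^sub>R v))) (at s)"
    by (simp only: o_def)
  moreover have "(\<lambda>t. fd u (x + s *\<^sub>R v) (t *\<^sub>R v)) = (*) (fd u (x + s *\<^sub>R v) v)"
    using linear_cmul[OF l] by (auto simp: fun_eq_iff)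
  ultimately show ?thesis by (simp only: has_field_derivative_def)
qed

text \<open>The mean value theorem is applied in direction v to the difference in direction w, then
  in direction w to the derivative along v. The left side does not change when v and w are
  exchanged, while the right side becomes the other mixed derivative.\<close>

lemma second_difference_mean_value:
  fixes u :: "'a::euclidean_space \<Rightarrow> real"
  assumes u: "smooth_on U u" and h: "h > 0"
    and box: "\<And>s t. 0 \<le> s \<Longrightarrow> s \<le> h \<Longrightarrow> 0 \<le> t \<Longrightarrow> t \<le> h \<Longrightarrow> p + s *\<^sub>R v + t *\<^sub>R w \<in> U"
  obtains s t where "0 \<le> s" "s \<le> h" "0 \<le> t" "t \<le> h"
    "u (p + h *\<^sub>R v + h *\<^sub>R w) - u (p + h *\<^sub>R v) - u (p + h *\<^sub>R w) + u p
      = h * h * fd (\<lambda>x. fd u x v) (p + s *\<^sub>R v + t *\<^sub>R w) w"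
proof -
  have box1: "p + s *\<^sub>R v \<in> U" if "0 \<le> s" "s \<le> h" for s using box[of s 0] that h by simp
  have "\<exists>s>0. s < h \<and> (u (p + h *\<^sub>R w + h *\<^sub>R v) - u (p + h *\<^sub>R v))
       - (u (p + h *\<^sub>R w + 0 *\<^sub>R v) - u (p + 0 *\<^sub>R v))
      = (h - 0) * (fd u (p + h *\<^sub>R w + s *\<^sub>R v) v - fd u (p + s *\<^sub>R v) v)"
  proof (rule MVT2[OF h])
    fix s :: real assume s: "0 \<le> s" "s \<le> h"
    have "p + h *\<^sub>R w + s *\<^sub>R v \<in> U" using box[of s h] s h by (simp add: ac_simps)
    then show "((\<lambda>s. u (p + h *\<^sub>R w + s *\<^sub>R v) - u (p + s *\<^sub>R v)) has_real_derivative
        fd u (p + h *\<^sub>R w + s *\<^sub>R v) v - fd u (p + s *\<^sub>R v) v) (at s)"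
      by (intro DERIV_diff smooth_on_line_has_derivative[OF u] box1 s)
  qed
  then obtain s where s: "0 < s" "s < h" and
    1: "(u (p + h *\<^sub>R w + h *\<^sub>R v) - u (p + h *\<^sub>R v)) - (u (p + h *\<^sub>R w) - u p)
      = h * (fd u (p + h *\<^sub>R w + s *\<^sub>R v) v - fd u (p + s *\<^sub>R v) v)" by auto
  have "\<exists>t>0. t < h \<and> fd u (p + s *\<^sub>R v + h *\<^sub>R w) v - fd u (p + s *\<^sub>R v + 0 *\<^sub>R w) v
      = (h - 0) * fd (\<lambda>x. fd u x v) (p + s *\<^sub>R v + t *\<^sub>R w) w"
    by (rule MVT2[OF h], rule smooth_on_line_has_derivative[OF smooth_on_frechet_derivative[OF u]],
        rule box) (use s in auto)
  then obtain t where t: "0 < t" "t < h" and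
    2: "fd u (p + h *\<^sub>R w + s *\<^sub>R v) v - fd u (p + s *\<^sub>R v) v
      = h * fd (\<lambda>x. fd u x v) (p + s *\<^sub>R v + t *\<^sub>R w) w" by (auto simp: ac_simps)
  from 1 2 that[of s t] s t show thesis by (simp add: ac_simps)
qed

text \<open>Exchanging v and w in the second difference equates the two mixed derivatives at two
  possibly different points near p; continuity at p closes the gap.\<close>

lemma second_derivative_symmetric:
  fixes u :: "'a::euclidean_space \<Rightarrow> real"
  assumes u: "smooth_on U u" and p: "p \<in> U"
  shows "fd (\<lambda>x. fd u x v) p w = fd (\<lambda>x. fd u x w) p v"
proof (rule ccontr)
  let ?a = "\<lambda>x. fd (\<lambda>x. fd u x v) x w" and ?b = "\<lambda>x. fd (\<lambda>x. fd u x w) x v"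
  assume "?a p \<noteq> ?b p"
  \<comment> \<open>Half the gap: values within e of the two distinct limits cannot
    coincide.\<close>
  define e where "e = \<bar>?a p - ?b p\<bar> / 2"
  have e: "e > 0" using \<open>?a p \<noteq> ?b p\<close> by (simp add: e_def)
  have U: "open U" using u by (simp add: smooth_on_def)
  have "isCont ?a p" "isCont ?b p"
    using smooth_on_continuous_on[OF smooth_on_frechet_derivative[OF smooth_on_frechet_derivative[OF u]]]
      U p by (auto simp: continuous_on_eq_continuous_at)
  then obtain d1 d2 where d: "d1 > 0" "d2 > 0"
    and d1: "\<And>x. dist x p < d1 \<Longrightarrow> dist (?a x) (?a p) < e"
    and d2: "\<And>x. dist x p < d2 \<Longrightarrow> dist (?b x) (?b p) < e"
    unfolding continuous_at_eps_delta using e by (elim allE[of _ e] impE exE conjE) auto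
  obtain d3 where d3: "d3 > 0" "ball p d3 \<subseteq> U" using U p openE by blast
  define M where "M = norm v + norm w + 1"
  \<comment> \<open>The parallelogram spanned by hv and hw lies within h * M of p, which is half of
    the smallest radius.\<close>
  define h where "h = Min {d1, d2, d3} / (2 * M)"
  have M: "M > 0" unfolding M_def by (smt (verit) norm_ge_zero)
  have h: "h > 0" unfolding h_def using d d3 M by (intro divide_pos_pos) auto
  have "Min {d1, d2, d3} > 0" "h * M = Min {d1, d2, d3} / 2" using d d3 M by (simp_all add: h_def)
  then have "h * M < Min {d1, d2, d3}" by linarith
  then have hM: "h * M < d1" "h * M < d2" "h * M < d3" by auto
  have near: "dist (p + s *\<^sub>R v + t *\<^sub>R w) p \<le> h * M"
    if "0 \<le> s" "s \<le> h" "0 \<le> t" "t \<le> h" for s t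
  proof -
    have "dist (p + s *\<^sub>R v + t *\<^sub>R w) p = norm (s *\<^sub>R v + t *\<^sub>R w)"
      by (simp add: dist_norm algebra_simps)
    also have "\<dots> \<le> s * norm v + t * norm w"
      using that by (intro order_trans[OF norm_triangle_ineq]) simp
    also have "\<dots> \<le> h * norm v + h * norm w"
      using that by (intro add_mono mult_right_mono) auto
    finally show ?thesis using h by (simp add: M_def algebra_simps)
  qed
  have box: "p + s *\<^sub>R v + t *\<^sub>R w \<in> U"
    if "0 \<le> s" "s \<le> h" "0 \<le> t" "t \<le> h" for s t
    using near[OF that] hM d3 by (auto simp: dist_commute intro: order.strict_trans1)
  obtain s t where st: "0 \<le> s" "s \<le> h" "0 \<le> t" "t \<le> h" and
    1: "u (p + h *\<^sub>R v + h *\<^sub>R w) - u (p + h *\<^sub>R v) - u (p + h *\<^sub>R w) + u p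
      = h * h * ?a (p + s *\<^sub>R v + t *\<^sub>R w)"
    using second_difference_mean_value[OF u h box] by blast
  have box': "p + s *\<^sub>R w + t *\<^sub>R v \<in> U"
    if "0 \<le> s" "s \<le> h" "0 \<le> t" "t \<le> h" for s t
    using box[OF that(3,4,1,2)] by (simp add: ac_simps)
  obtain s' t' where st': "0 \<le> s'" "s' \<le> h" "0 \<le> t'" "t' \<le> h" and
    2: "u (p + h *\<^sub>R w + h *\<^sub>R v) - u (p + h *\<^sub>R w) - u (p + h *\<^sub>R v) + u p
      = h * h * ?b (p + s' *\<^sub>R w + t' *\<^sub>R v)"
    using second_difference_mean_value[OF u h box'] by blast
  have "h * h * ?a (p + s *\<^sub>R v + t *\<^sub>R w) = h * h * ?b (p + s' *\<^sub>R w + t' *\<^sub>R v)"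
  proof -
    have "p + h *\<^sub>R w + h *\<^sub>R v = p + h *\<^sub>R v + h *\<^sub>R w" by (simp add: ac_simps)
    with 1 2 show ?thesis by (simp only:)
  qed
  then have "?a (p + s *\<^sub>R v + t *\<^sub>R w) = ?b (p + t' *\<^sub>R v + s' *\<^sub>R w)"
    using h by (simp add: ac_simps)
  moreover have "dist (?a (p + s *\<^sub>R v + t *\<^sub>R w)) (?a p) < e"
    by (rule d1) (use near[OF st] hM in linarith)
  moreover have "dist (?b (p + t' *\<^sub>R v + s' *\<^sub>R w)) (?b p) < e"
    by (rule d2) (use near[OF st'(3,4,1,2)] hM in linarith)
  ultimately show False unfolding e_def dist_real_def by argo
qed

text \<open>For w with f' w = 1, consider the points q + s (v + \<tau> w). To first order f equals s
  \<tau> there, so it changes sign for \<tau> between -\<eta> and \<eta> and has a zero; at that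
  zero g is about s (g' v + \<tau> g' w), which is nonzero if g' v is and \<eta> is small. The
  intermediate value theorem does the work of an implicit function.\<close>

lemma has_derivative_zero_set_kernel:
  fixes f g :: "'a::real_normed_vector \<Rightarrow> real"
  assumes f: "(f has_derivative f') (at q)" and g: "(g has_derivative g') (at q)"
    and U: "open U" "q \<in> U" and cont: "continuous_on U f"
    and zero: "f q = 0" "g q = 0" "\<And>x. x \<in> U \<Longrightarrow> f x = 0 \<Longrightarrow> g x = 0"
    and f'w: "f' w \<noteq> 0" and v: "f' v = 0"
  shows "g' v = 0"
proof (rule ccontr)
  assume gv: "g' v \<noteq> 0"
  interpret f': bounded_linear f' using f by (rule has_derivative_bounded_linear)
  interpret g': bounded_linear g' using g by (rule has_derivative_bounded_linear)
  define w' where "w' = (1 / f' w) *\<^sub>R w"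
  have fw': "f' w' = 1" using f'w by (simp add: w'_def f'.scaleR)
  \<comment> \<open>So small that tilting v by a multiple \<tau> w' with \<bar>\<tau>\<bar> \<le>
    \<eta> changes the value of g' by at most half of \<bar>g' v\<bar>.\<close>
  define \<eta> where "\<eta> = \<bar>g' v\<bar> / (2 * (\<bar>g' w'\<bar> + 1))"
  have \<eta>: "\<eta> > 0" using gv by (simp add: \<eta>_def)
  have \<eta>g: "\<eta> * \<bar>g' w'\<bar> \<le> \<bar>g' v\<bar> / 2"
    unfolding \<eta>_def by (simp add: field_simps)
  define M where "M = norm v + \<eta> * norm w' + 1"
  have M: "M > 0" using \<eta> by (simp add: M_def add_nonneg_pos)
  \<comment> \<open>An error of e per unit of length, over a length of at most s * M, stays below
    both s * \<eta> and s * \<bar>g' v\<bar> / 2.\<close>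
  define e where "e = min \<eta> (\<bar>g' v\<bar> / 2) / (2 * M)"
  have "min \<eta> (\<bar>g' v\<bar> / 2) > 0" "e * M = min \<eta> (\<bar>g' v\<bar> / 2) / 2"
    using \<eta> gv M by (simp_all add: e_def)
  moreover have "min \<eta> (\<bar>g' v\<bar> / 2) \<le> \<eta>" "min \<eta> (\<bar>g' v\<bar> / 2) \<le> \<bar>g' v\<bar> / 2" by auto
  moreover have "e > 0" using \<eta> gv M by (auto simp: e_def intro!: divide_pos_pos)
  ultimately have e: "e > 0" "e * M < \<eta>" "e * M < \<bar>g' v\<bar> / 2" by linarith+
  obtain d1 where d1: "d1 > 0"
    "\<And>y. norm (y - q) < d1 \<Longrightarrow> \<bar>f y - f' (y - q)\<bar> \<le> e * norm (y - q)"
    using f e(1) zero(1) unfolding has_derivative_at_alt by fastforce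
  obtain d2 where d2: "d2 > 0"
    "\<And>y. norm (y - q) < d2 \<Longrightarrow> \<bar>g y - g' (y - q)\<bar> \<le> e * norm (y - q)"
    using g e(1) zero(2) unfolding has_derivative_at_alt by fastforce
  obtain d3 where d3: "d3 > 0" "ball q d3 \<subseteq> U" using U openE by blast
  define s where "s = Min {d1, d2, d3} / (2 * M)"
  have "Min {d1, d2, d3} > 0" "s * M = Min {d1, d2, d3} / 2"
    using d1(1) d2(1) d3(1) M by (simp_all add: s_def)
  then have "s * M < Min {d1, d2, d3}" and s: "s > 0"
    using M by (linarith, auto simp: s_def intro!: divide_pos_pos)
  then have sM: "s * M < d1" "s * M < d2" "s * M < d3" by auto
  define c where "c \<tau> = q + s *\<^sub>R (v + \<tau> *\<^sub>R w')" for \<tau>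
  have nc: "norm (c \<tau> - q) \<le> s * M" if "\<bar>\<tau>\<bar> \<le> \<eta>" for \<tau>
  proof -
    have "norm (v + \<tau> *\<^sub>R w') \<le> norm v + \<bar>\<tau>\<bar> * norm w'"
      by (intro order_trans[OF norm_triangle_ineq]) simp
    also have "\<dots> \<le> M" using mult_right_mono[OF that, of "norm w'"] by (simp add: M_def)
    finally show ?thesis using s by (simp add: c_def)
  qed
  have fc: "\<bar>f (c \<tau>) - s * \<tau>\<bar> < s * \<eta>" if "\<bar>\<tau>\<bar> \<le> \<eta>" for \<tau>
  proof -
    have "\<bar>f (c \<tau>) - f' (c \<tau> - q)\<bar> \<le> e * norm (c \<tau> - q)"
      using nc[OF that] sM by (intro d1) linarith
    also have "\<dots> \<le> e * (s * M)" using nc[OF that] e(1) by (intro mult_left_mono) auto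
    also have "\<dots> = s * (e * M)" by simp
    also have "\<dots> < s * \<eta>" using e(2) s by simp
    finally show ?thesis by (simp add: c_def f'.scaleR f'.add v fw')
  qed
  have gc: "\<bar>g (c \<tau>) - s * (g' v + \<tau> * g' w')\<bar> < s * (\<bar>g' v\<bar> / 2)" if "\<bar>\<tau>\<bar> \<le> \<eta>" for \<tau>
  proof -
    have "\<bar>g (c \<tau>) - g' (c \<tau> - q)\<bar> \<le> e * norm (c \<tau> - q)"
      using nc[OF that] sM by (intro d2) linarith
    also have "\<dots> \<le> e * (s * M)" using nc[OF that] e(1) by (intro mult_left_mono) auto
    also have "\<dots> = s * (e * M)" by simp
    also have "\<dots> < s * (\<bar>g' v\<bar> / 2)" using e(3) s by simp
    finally show ?thesis by (simp add: c_def g'.scaleR g'.add)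
  qed
  have cU: "c \<tau> \<in> U" if "\<bar>\<tau>\<bar> \<le> \<eta>" for \<tau>
    using nc[OF that] sM d3(2) by (auto simp: dist_norm norm_minus_commute subset_iff)
  have "continuous_on {-\<eta>..\<eta>} (\<lambda>\<tau>. f (c \<tau>))"
    by (rule continuous_on_compose2[OF cont]) (auto simp: c_def[abs_def] intro!: continuous_intros cU[unfolded c_def])
  moreover have "f (c (-\<eta>)) \<le> 0" "0 \<le> f (c \<eta>)" using fc[of "-\<eta>"] fc[of \<eta>] \<eta> by auto
  ultimately obtain \<tau> where \<tau>: "-\<eta> \<le> \<tau>" "\<tau> \<le> \<eta>" "f (c \<tau>) = 0"
    using IVT'[of "\<lambda>\<tau>. f (c \<tau>)" "-\<eta>" 0 \<eta>] \<eta> by auto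
  then have "\<bar>\<tau>\<bar> \<le> \<eta>" by auto
  then have "s * \<bar>g' v + \<tau> * g' w'\<bar> < s * (\<bar>g' v\<bar> / 2)"
    using gc[of \<tau>] zero(3)[OF cU \<tau>(3)] s by (simp add: abs_mult)
  then have "\<bar>g' v + \<tau> * g' w'\<bar> < \<bar>g' v\<bar> / 2" using s by simp
  moreover have "\<bar>\<tau> * g' w'\<bar> \<le> \<bar>g' v\<bar> / 2"
    using \<eta>g mult_right_mono[OF \<open>\<bar>\<tau>\<bar> \<le> \<eta>\<close>, of "\<bar>g' w'\<bar>"] by (simp add: abs_mult)
  ultimately show False by argo
qed

section \<open>Independence of the tangent plane from the defining function\<close>

lemma local_defining_function_move:
  "local_defining_function \<Sigma> p U u \<Longrightarrow> q \<in> \<Sigma> \<inter> U \<Longrightarrow> local_defining_function \<Sigma> q U u"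
  by (simp add: local_defining_function_def)

lemma local_defining_function_kernel:
  assumes 1: "local_defining_function \<Sigma> q U\<^sub>1 u\<^sub>1" and 2: "local_defining_function \<Sigma> q U\<^sub>2 u\<^sub>2"
    and v: "fd u\<^sub>1 q v = 0"
  shows "fd u\<^sub>2 q v = 0"
proof -
  note 1 = 1[unfolded local_defining_function_def] and 2 = 2[unfolded local_defining_function_def]
  obtain w where w: "fd u\<^sub>1 q w \<noteq> 0" using 1 by (meson ext)
  show ?thesis
  proof (rule has_derivative_zero_set_kernel[of u\<^sub>1 _ _ u\<^sub>2 _ "U\<^sub>1 \<inter> U\<^sub>2"])
    show "(u\<^sub>1 has_derivative fd u\<^sub>1 q) (at q)" "(u\<^sub>2 has_derivative fd u\<^sub>2 q) (at q)"
      using 1 2 smooth_on_has_derivative by blast+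
    show "continuous_on (U\<^sub>1 \<inter> U\<^sub>2) u\<^sub>1"
      using 1 smooth_on_continuous_on continuous_on_subset by blast
  qed (use 1 2 v w in auto)
qed

text \<open>The definition admits all defining functions at q at once; they have a common kernel, so
  each of them computes the plane.\<close>

lemma tangent_plane_eq:
  "local_defining_function \<Sigma> q U u \<Longrightarrow> tangent_plane \<Sigma> q = {v. fd u q v = 0}"
  unfolding tangent_plane_def using local_defining_function_kernel by blast

lemma characteristic_imp_horizontal_deriv_zero:
  assumes "local_defining_function \<Sigma> q U u" "q \<in> characteristic_set \<Sigma>"
  shows "vf_deriv heis_X u q = 0" "vf_deriv heis_Y u q = 0"
proof -
  have "heis_X q \<in> distribution q" "heis_Y q \<in> distribution q"
    by (simp_all add: distribution_def contact_form_def heis_X_def heis_Y_def)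
  then show "vf_deriv heis_X u q = 0" "vf_deriv heis_Y u q = 0"
    using assms(2) tangent_plane_eq[OF assms(1)]
    by (auto simp: characteristic_set_def vf_deriv_def)
qed

lemma critical_curve_imp_deriv_zero:
  "local_defining_function \<Sigma> q U u \<Longrightarrow> q \<in> critical_curve \<Sigma> n \<Longrightarrow> vf_deriv (field_N n) u q = 0"
  using tangent_plane_eq by (auto simp: critical_curve_def vf_deriv_def)

section \<open>Left-invariant horizontal fields\<close>

lemma field_N_eq: "field_N m q = vector [m $ 1, m $ 2, (m $ 2 * q $ 1 - m $ 1 * q $ 2) / 2]"
  by (simp add: vec_eq_iff forall_3 field_N_def heis_X_def heis_Y_def field_simps)

text \<open>T is the left-invariant field with rotated coefficients. Together with the next two
  facts this reduces all horizontal derivatives to \<open>field_N\<close>.\<close>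

lemma field_T_eq: "field_T m = field_N (vector [- (m $ 2), m $ 1])"
  by (simp add: fun_eq_iff field_N_def field_T_def)

lemma heis_X_eq: "heis_X = field_N (vector [1, 0])"
  by (simp add: fun_eq_iff field_N_def)

lemma heis_Y_eq: "heis_Y = field_N (vector [0, 1])"
  by (simp add: fun_eq_iff field_N_def)

lemma linear_real3_expansion:
  fixes L :: "real^3 \<Rightarrow> real"
  assumes "linear L"
  shows "L v = v $ 1 * L (axis 1 1) + v $ 2 * L (axis 2 1) + v $ 3 * L (axis 3 1)"
proof -
  have "v = v $ 1 *\<^sub>R axis 1 1 + v $ 2 *\<^sub>R axis 2 1 + v $ 3 *\<^sub>R axis 3 1"
    by (simp add: vec_eq_iff forall_3 axis_def)
  then have "L v = L (v $ 1 *\<^sub>R axis 1 1 + v $ 2 *\<^sub>R axis 2 1 + v $ 3 *\<^sub>R axis 3 1)" by (rule arg_cong)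
  then show ?thesis by (simp only: linear_add[OF assms] linear_cmul[OF assms] real_scaleR_def)
qed

lemma vf_deriv_field_N:
  assumes "f differentiable (at q)"
  shows "vf_deriv (field_N m) f q = m $ 1 * fd f q (axis 1 1) + m $ 2 * fd f q (axis 2 1)
    + (m $ 2 * q $ 1 - m $ 1 * q $ 2) / 2 * fd f q (axis 3 1)"
  using linear_real3_expansion[OF linear_frechet_derivative[OF assms], of "field_N m q"]
  by (simp add: vf_deriv_def field_N_eq)

lemma vf_deriv_field_N_frame:
  assumes "f differentiable (at q)"
  shows "vf_deriv (field_N m) f q = m $ 1 * vf_deriv heis_X f q + m $ 2 * vf_deriv heis_Y f q"
  using linear_frechet_derivative[OF assms]
  by (simp add: vf_deriv_def field_N_def linear_add linear_cmul)

lemma norm_eq_1_real2: "norm (n :: real^2) = 1 \<Longrightarrow> (n $ 1)\<^sup>2 + (n $ 2)\<^sup>2 = 1"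
  by (simp add: norm_vec_def L2_set_def sum_2)

text \<open>(N, T) arises from the orthonormal frame (X, Y) by a rotation, n being a unit
  vector.\<close>

lemma hor_grad_norm_rotate:
  assumes "f differentiable (at q)" "norm n = 1"
  shows "(hor_grad_norm f q)\<^sup>2 = (vf_deriv (field_N n) f q)\<^sup>2 + (vf_deriv (field_T n) f q)\<^sup>2"
proof -
  let ?x = "vf_deriv heis_X f q" and ?y = "vf_deriv heis_Y f q"
  have "(n $ 1 * ?x + n $ 2 * ?y)\<^sup>2 + (- n $ 2 * ?x + n $ 1 * ?y)\<^sup>2
      = ((n $ 1)\<^sup>2 + (n $ 2)\<^sup>2) * (?x\<^sup>2 + ?y\<^sup>2)"
    by (simp add: power2_eq_square algebra_simps)
  then show ?thesis
    using assms(2) by (simp add: hor_grad_norm_def field_T_eq vf_deriv_field_N_frame[OF assms(1)]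
        norm_eq_1_real2)
qed

lemma hor_grad_norm_ge:
  assumes "f differentiable (at q)" "norm n = 1"
  shows "\<bar>vf_deriv (field_N n) f q\<bar> \<le> hor_grad_norm f q" "\<bar>vf_deriv (field_T n) f q\<bar> \<le> hor_grad_norm f q"
proof -
  have "0 \<le> hor_grad_norm f q" by (simp add: hor_grad_norm_def)
  then show "\<bar>vf_deriv (field_N n) f q\<bar> \<le> hor_grad_norm f q" "\<bar>vf_deriv (field_T n) f q\<bar> \<le> hor_grad_norm f q"
    using hor_grad_norm_rotate[OF assms] by (auto intro!: power2_le_imp_le[of "\<bar>_\<bar>"])
qed

lemma smooth_on_cong:
  assumes "smooth_on U f" "\<And>x. x \<in> U \<Longrightarrow> f x = g x"
  shows "smooth_on U g"
  using assms(1) Ck_on_cong_imp[of U f g, OF _ assms(2)] unfolding smooth_on_def by blast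

lemma smooth_on_vec_nth: "open U \<Longrightarrow> smooth_on U (\<lambda>q. q $ i :: real)"
  by (rule smooth_on_linear[OF _ bounded_linear_vec_nth])

lemma smooth_on_vf_deriv_field_N:
  assumes "smooth_on U u"
  shows "smooth_on U (vf_deriv (field_N m) u)"
proof -
  have U: "open U" using assms by (simp add: smooth_on_def)
  show ?thesis
  proof (rule smooth_on_cong)
    show "smooth_on U (\<lambda>q. m $ 1 * fd u q (axis 1 1) + m $ 2 * fd u q (axis 2 1)
    + (m $ 2 / 2 * q $ 1 + (- m $ 1 / 2) * q $ 2) * fd u q (axis 3 1))"
    by (intro smooth_on_add smooth_on_mult smooth_on_const[OF U] smooth_on_vec_nth[OF U]
        smooth_on_frechet_derivative[OF assms])
    show "m $ 1 * fd u q (axis 1 1) + m $ 2 * fd u q (axis 2 1)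
      + (m $ 2 / 2 * q $ 1 + (- m $ 1 / 2) * q $ 2) * fd u q (axis 3 1) = vf_deriv (field_N m) u q"
      if "q \<in> U" for q
      unfolding vf_deriv_field_N[OF smooth_on_differentiable[OF assms that]] by (simp add: field_simps)
  qed
qed

text \<open>The last summand comes from the coefficient of \<partial>z in the field, which depends
  on the point; it is the only source of noncommutativity.\<close>

lemma fd_vf_deriv_field_N:
  assumes u: "smooth_on U u" and q: "q \<in> U"
  shows "fd (vf_deriv (field_N m) u) q w =
    m $ 1 * fd (\<lambda>x. fd u x (axis 1 1)) q w + m $ 2 * fd (\<lambda>x. fd u x (axis 2 1)) q w
    + (m $ 2 * q $ 1 - m $ 1 * q $ 2) / 2 * fd (\<lambda>x. fd u x (axis 3 1)) q w
    + (m $ 2 * w $ 1 - m $ 1 * w $ 2) / 2 * fd u q (axis 3 1)"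
proof -
  have U: "open U" using u by (simp add: smooth_on_def)
  note d = smooth_on_has_derivative[OF smooth_on_frechet_derivative[OF u] q]
  have "((\<lambda>q. m $ 2 * q $ 1 - m $ 1 * q $ 2) has_derivative (\<lambda>w. m $ 2 * w $ 1 - m $ 1 * w $ 2)) (at q)"
    by (intro has_derivative_diff has_derivative_mult_right bounded_linear_imp_has_derivative
        bounded_linear_vec_nth)
  from has_derivative_mult[OF has_derivative_mult_right[OF this, of "1/2"] d[of "axis 3 1"]]
  have "((\<lambda>q. m $ 1 * fd u q (axis 1 1) + m $ 2 * fd u q (axis 2 1)
      + 1 / 2 * (m $ 2 * q $ 1 - m $ 1 * q $ 2) * fd u q (axis 3 1)) has_derivative
    (\<lambda>w. m $ 1 * fd (\<lambda>x. fd u x (axis 1 1)) q w + m $ 2 * fd (\<lambda>x. fd u x (axis 2 1)) q w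
      + (1 / 2 * (m $ 2 * q $ 1 - m $ 1 * q $ 2) * fd (\<lambda>x. fd u x (axis 3 1)) q w
      + 1 / 2 * (m $ 2 * w $ 1 - m $ 1 * w $ 2) * fd u q (axis 3 1)))) (at q)"
    by (intro has_derivative_add has_derivative_mult_right d)
  then have "(vf_deriv (field_N m) u has_derivative
    (\<lambda>w. m $ 1 * fd (\<lambda>x. fd u x (axis 1 1)) q w + m $ 2 * fd (\<lambda>x. fd u x (axis 2 1)) q w
      + (1 / 2 * (m $ 2 * q $ 1 - m $ 1 * q $ 2) * fd (\<lambda>x. fd u x (axis 3 1)) q w
      + 1 / 2 * (m $ 2 * w $ 1 - m $ 1 * w $ 2) * fd u q (axis 3 1)))) (at q)"
    by (rule has_derivative_transform_within_open[OF _ U q])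
       (simp add: vf_deriv_field_N[OF smooth_on_differentiable[OF u]])
  from frechet_derivative_eqI[OF this] show ?thesis by simp
qed

text \<open>The commutator of two left-invariant horizontal fields is det(m, l) \<partial>z. The
  second-order terms cancel by the symmetry of mixed derivatives.\<close>

lemma field_N_commutator:
  assumes u: "smooth_on U u" and q: "q \<in> U"
  shows "vf_deriv (field_N m) (vf_deriv (field_N l) u) q - vf_deriv (field_N l) (vf_deriv (field_N m) u) q
    = (m $ 1 * l $ 2 - m $ 2 * l $ 1) * fd u q (axis 3 1)"
proof -
  let ?a = "\<lambda>i j. fd (\<lambda>x. fd u x (axis i 1)) q (axis j (1::real))"
  have s: "?a 2 1 = ?a 1 2" "?a 3 1 = ?a 1 3" "?a 3 2 = ?a 2 3"
    using second_derivative_symmetric[OF u q] by blast+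
  have e: "fd (\<lambda>x. fd u x (axis i 1)) q (field_N k q)
      = k $ 1 * ?a i 1 + k $ 2 * ?a i 2 + (k $ 2 * q $ 1 - k $ 1 * q $ 2) / 2 * ?a i 3" for i k
    using linear_real3_expansion[OF smooth_on_linear_fd[OF smooth_on_frechet_derivative[OF u, of "axis i 1"] q],
        of "field_N k q"] by (simp add: field_N_eq)
  show ?thesis
    unfolding vf_deriv_def[of "field_N m" "vf_deriv _ _"] vf_deriv_def[of "field_N l" "vf_deriv _ _"]
      fd_vf_deriv_field_N[OF u q] e s
    by (simp add: field_N_eq) (simp add: field_simps)
qed

text \<open>Left-invariant fields have constant coefficients in the frame X, Y, so these pass
  through the derivatives. The first slot is the outer derivative, which matters because the two
  derivatives need not commute.\<close>

lemma hor_Hess_eq: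
  assumes u: "smooth_on U u" and q: "q \<in> U"
  shows "hor_Hess u q m l = vf_deriv (field_N m) (vf_deriv (field_N l) u) q"
proof -
  have U: "open U" using u by (simp add: smooth_on_def)
  have X: "smooth_on U (vf_deriv heis_X u)" and Y: "smooth_on U (vf_deriv heis_Y u)"
    unfolding heis_X_eq heis_Y_eq by (rule smooth_on_vf_deriv_field_N[OF u])+
  have "((\<lambda>x. l $ 1 * vf_deriv heis_X u x + l $ 2 * vf_deriv heis_Y u x) has_derivative
    (\<lambda>w. l $ 1 * fd (vf_deriv heis_X u) q w + l $ 2 * fd (vf_deriv heis_Y u) q w)) (at q)"
    by (intro has_derivative_add has_derivative_mult_right smooth_on_has_derivative[OF _ q] X Y)
  then have "(vf_deriv (field_N l) u has_derivative
    (\<lambda>w. l $ 1 * fd (vf_deriv heis_X u) q w + l $ 2 * fd (vf_deriv heis_Y u) q w)) (at q)"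
    by (rule has_derivative_transform_within_open[OF _ U q])
       (simp add: vf_deriv_field_N_frame[OF smooth_on_differentiable[OF u]])
  from frechet_derivative_eqI[OF this]
  have "vf_deriv (field_N m) (vf_deriv (field_N l) u) q
    = l $ 1 * vf_deriv (field_N m) (vf_deriv heis_X u) q + l $ 2 * vf_deriv (field_N m) (vf_deriv heis_Y u) q"
    by (simp add: vf_deriv_def[of "field_N m"])
  then show ?thesis
    unfolding vf_deriv_field_N_frame[OF smooth_on_differentiable[OF X q]]
      vf_deriv_field_N_frame[OF smooth_on_differentiable[OF Y q]]
    by (simp add: hor_Hess_def hor_Hess_matrix_def sum_2 heis_frame_def algebra_simps)
qed

section \<open>One-variable estimates\<close>

lemma frechet_derivative_real_eq_deriv:
  fixes f :: "real \<Rightarrow> real"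
  assumes "f differentiable (at x)"
  shows "fd f x 1 = deriv f x" "(f has_real_derivative deriv f x) (at x)"
proof -
  show d: "(f has_real_derivative deriv f x) (at x)"
    using assms DERIV_deriv_iff_real_differentiable by blast
  then show "fd f x 1 = deriv f x"
    using frechet_derivative_eqI unfolding has_field_derivative_def by fastforce
qed

lemma smooth_on_funpow_deriv:
  fixes f :: "real \<Rightarrow> real"
  assumes "smooth_on I f"
  shows "smooth_on I ((deriv ^^ m) f)"
proof (induction m)
  case (Suc m)
  have "smooth_on I (\<lambda>x. fd ((deriv ^^ m) f) x 1)" by (rule smooth_on_frechet_derivative[OF Suc])
  then show ?case
    by (rule smooth_on_cong)
      (simp add: frechet_derivative_real_eq_deriv(1)[OF smooth_on_differentiable[OF Suc]])
qed (use assms in simp)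

text \<open>With j the order of the zero, Taylor's formula consists of its remainder only, and near
  0 the coefficient of the remainder keeps at least half of its size at 0.\<close>

lemma smooth_finite_order_zero_lower_bound:
  fixes f :: "real \<Rightarrow> real"
  assumes f: "smooth_on {-\<epsilon><..<\<epsilon>} f" and \<epsilon>: "\<epsilon> > 0" and k: "(deriv ^^ k) f 0 \<noteq> 0"
  obtains j c \<delta> where "c > 0" "0 < \<delta>" "\<delta> \<le> \<epsilon>" "\<And>s. \<bar>s\<bar> < \<delta> \<Longrightarrow> c * \<bar>s\<bar> ^ j \<le> \<bar>f s\<bar>"
proof -
  define j where "j = (LEAST k. (deriv ^^ k) f 0 \<noteq> 0)"
  define D where "D m = (deriv ^^ m) f" for m
  have Dj: "D j 0 \<noteq> 0" unfolding j_def D_def by (rule LeastI[of _ k]) (rule k)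
  have D0: "D m 0 = 0" if "m < j" for m
    using not_less_Least[of m "\<lambda>k. (deriv ^^ k) f 0 \<noteq> 0"] that by (auto simp: j_def D_def)
  have sm: "smooth_on {-\<epsilon><..<\<epsilon>} (D m)" for m
    unfolding D_def by (rule smooth_on_funpow_deriv[OF f])
  have der: "(D m has_real_derivative D (Suc m) t) (at t)" if "\<bar>t\<bar> < \<epsilon>" for m t
    using frechet_derivative_real_eq_deriv(2)[OF smooth_on_differentiable[OF sm[of m], of t]] that
    by (simp add: D_def abs_less_iff minus_less_iff)
  have "isCont (D j) 0"
    using DERIV_isCont[OF der[of 0 j]] \<epsilon> by simp
  moreover have "\<bar>D j 0\<bar> / 2 > 0" using Dj by simp
  ultimately obtain d where d: "d > 0" "\<And>t. dist t 0 < d \<Longrightarrow> dist (D j t) (D j 0) < \<bar>D j 0\<bar> / 2"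
    unfolding continuous_at_eps_delta by blast
  show thesis
  proof
    show "\<bar>D j 0\<bar> / 2 / fact j > 0" using Dj by simp
    show "0 < min d \<epsilon>" "min d \<epsilon> \<le> \<epsilon>" using d \<epsilon> by auto
    fix s :: real assume s: "\<bar>s\<bar> < min d \<epsilon>"
    have "\<exists>t. \<bar>t\<bar> \<le> \<bar>s\<bar> \<and> f s = (\<Sum>m<j. D m 0 / fact m * s ^ m) + D j t / fact j * s ^ j"
      by (rule Maclaurin_bi_le) (use der s in \<open>auto simp: D_def[of 0]\<close>)
    then obtain t where t: "\<bar>t\<bar> \<le> \<bar>s\<bar>" "f s = D j t / fact j * s ^ j"
      using D0 by auto
    have "dist (D j t) (D j 0) < \<bar>D j 0\<bar> / 2" using d(2)[of t] t(1) s by simp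
    then have "\<bar>D j 0\<bar> / 2 \<le> \<bar>D j t\<bar>" unfolding dist_real_def by argo
    then have "\<bar>D j 0\<bar> / 2 / fact j * \<bar>s\<bar> ^ j \<le> \<bar>D j t\<bar> / fact j * \<bar>s\<bar> ^ j"
      by (intro mult_right_mono divide_right_mono) auto
    then show "\<bar>D j 0\<bar> / 2 / fact j * \<bar>s\<bar> ^ j \<le> \<bar>f s\<bar>"
      by (simp add: t(2) abs_mult power_abs)
  qed
qed

text \<open>With a derivative at 0 only, the intermediate value theorem replaces an inverse of m.
  The estimate bounds \<bar>s\<bar> from below by a multiple of \<bar>\<sigma> - m 0\<bar>, which is
  what turns a lower bound in s into one in \<sigma>; the factor 2 rounds up 3/2.\<close>

lemma real_local_preimage_bound:
  fixes m :: "real \<Rightarrow> real"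
  assumes der: "(m has_real_derivative m') (at 0)" and m': "m' \<noteq> 0"
    and cont: "continuous_on {-\<delta><..<\<delta>} m" and \<delta>: "\<delta> > 0"
  obtains r where "r > 0"
    "\<And>\<sigma>. \<bar>\<sigma> - m 0\<bar> < r \<Longrightarrow> \<exists>s. \<bar>s\<bar> < \<delta> \<and> m s = \<sigma> \<and> \<bar>\<sigma> - m 0\<bar> \<le> 2 * \<bar>m'\<bar> * \<bar>s\<bar>"
proof -
  have "(m has_derivative (*) m') (at 0)" using der by (simp add: has_field_derivative_def)
  moreover have "\<bar>m'\<bar> / 2 > 0" using m' by simp
  ultimately obtain d0 where d0: "d0 > 0"
    "\<And>s. norm (s - 0) < d0 \<Longrightarrow> norm (m s - m 0 - m' * (s - 0)) \<le> \<bar>m'\<bar> / 2 * norm (s - 0)"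
    unfolding has_derivative_at_alt by blast
  define d where "d = min d0 \<delta> / 2"
  have d: "d > 0" "d < d0" "d < \<delta>" using d0 \<delta> by (auto simp: d_def)
  have est: "\<bar>m s - m 0 - m' * s\<bar> \<le> \<bar>m'\<bar> / 2 * \<bar>s\<bar>" if "\<bar>s\<bar> \<le> d" for s
    using d0(2)[of s] that d by simp
  have c: "continuous_on {-d..d} m" using d by (intro continuous_on_subset[OF cont]) auto
  show thesis
  proof
    \<comment> \<open>At the two ends of [-d, d] the map is at least this far from m 0, on opposite
      sides.\<close>
    show "\<bar>m'\<bar> * d / 2 > 0" using m' d by simp
    fix \<sigma> assume \<sigma>: "\<bar>\<sigma> - m 0\<bar> < \<bar>m'\<bar> * d / 2"
    have e: "\<bar>m d - m 0 - m' * d\<bar> \<le> \<bar>m'\<bar> * d / 2" "\<bar>m (-d) - m 0 + m' * d\<bar> \<le> \<bar>m'\<bar> * d / 2"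
      using est[of d] est[of "-d"] d by auto
    have "\<exists>s\<ge>-d. s \<le> d \<and> m s = \<sigma>"
    proof (cases "m' > 0")
      case True
      then have "\<bar>m'\<bar> * d = m' * d" by simp
      with e \<sigma> have "m (-d) \<le> \<sigma>" "\<sigma> \<le> m d" by argo+
      then show ?thesis using IVT'[of m "-d" \<sigma> d] c d by auto
    next
      case False
      then have "\<bar>m'\<bar> * d = - (m' * d)" by simp
      with e \<sigma> have "m d \<le> \<sigma>" "\<sigma> \<le> m (-d)" by argo+
      then show ?thesis using IVT2'[of m d \<sigma> "-d"] c d by auto
    qed
    then obtain s where s: "-d \<le> s" "s \<le> d" "m s = \<sigma>" by blast
    then have sd: "\<bar>s\<bar> \<le> d" by auto
    have "\<bar>m s - m 0\<bar> \<le> \<bar>m' * s\<bar> + \<bar>m'\<bar> / 2 * \<bar>s\<bar>" using est[OF sd] by argo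
    also have "\<dots> \<le> 2 * \<bar>m'\<bar> * \<bar>s\<bar>" by (simp add: abs_mult)
    finally show "\<exists>s. \<bar>s\<bar> < \<delta> \<and> m s = \<sigma> \<and> \<bar>\<sigma> - m 0\<bar> \<le> 2 * \<bar>m'\<bar> * \<bar>s\<bar>"
      using s sd d by (intro exI[of _ s]) auto
  qed
qed

text \<open>Translation and reflection cover the interval by two copies of [0, \<bar>r\<bar>], where
  the integral is explicit because \<alpha> < 1.\<close>

lemma nn_integral_inverse_powr_finite:
  fixes \<alpha> r a :: real
  assumes \<alpha>: "0 \<le> \<alpha>" "\<alpha> < 1"
  shows "(\<integral>\<^sup>+x. 1 / ennreal (\<bar>x - a\<bar> powr \<alpha>) * indicator {a - r<..<a + r} x \<partial>lborel) < \<infinity>"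
proof -
  let ?g = "\<lambda>x. 1 / ennreal (\<bar>x\<bar> powr \<alpha>) * indicator {0..\<bar>r\<bar>} x"
  have "((\<lambda>x. x powr - \<alpha>) has_integral (\<bar>r\<bar> powr (- \<alpha> + 1) / (- \<alpha> + 1))) {0..\<bar>r\<bar>}"
    using \<alpha> by (intro has_integral_powr_from_0) auto
  from nn_integral_has_integral_lebesgue'[OF _ this]
  have "(\<integral>\<^sup>+x. ennreal (x powr - \<alpha>) * indicator {0..\<bar>r\<bar>} x \<partial>lborel) < \<infinity>" by simp
  also have "(\<integral>\<^sup>+x. ennreal (x powr - \<alpha>) * indicator {0..\<bar>r\<bar>} x \<partial>lborel) = (\<integral>\<^sup>+x. ?g x \<partial>lborel)"
  proof (rule nn_integral_cong_AE)
    \<comment> \<open>At 0 the two integrands differ: \<open>0 powr (- \<alpha>)\<close> is 0, while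
      the reciprocal of \<open>0 powr \<alpha>\<close> is infinite.\<close>
    have "ennreal (x powr - \<alpha>) * indicator {0..\<bar>r\<bar>} x = ?g x" if "x \<noteq> 0" for x :: real
      using that divide_ennreal[of 1 "\<bar>x\<bar> powr \<alpha>"] by (auto simp: indicator_def powr_minus_divide)
    then show "AE x in lborel. ennreal (x powr - \<alpha>) * indicator {0..\<bar>r\<bar>} x = ?g x"
      using AE_lborel_singleton[of "0::real"] by auto
  qed
  finally have fin: "(\<integral>\<^sup>+x. ?g x \<partial>lborel) < \<infinity>" .
  have [measurable]: "?g \<in> borel_measurable borel" by measurable
  have pos: "(\<integral>\<^sup>+x. ?g (x - a) \<partial>lborel) = (\<integral>\<^sup>+x. ?g x \<partial>lborel)"
    using nn_integral_real_affine[of ?g 1 "-a"] by simp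
  have neg: "(\<integral>\<^sup>+x. ?g (a - x) \<partial>lborel) = (\<integral>\<^sup>+x. ?g x \<partial>lborel)"
    using nn_integral_real_affine[of ?g "-1" a] by simp
  have "(\<integral>\<^sup>+x. 1 / ennreal (\<bar>x - a\<bar> powr \<alpha>) * indicator {a - r<..<a + r} x \<partial>lborel)
      \<le> (\<integral>\<^sup>+x. ?g (x - a) + ?g (a - x) \<partial>lborel)"
    by (rule nn_integral_mono) (auto simp: indicator_def abs_minus_commute)
  also have "\<dots> = (\<integral>\<^sup>+x. ?g (x - a) \<partial>lborel) + (\<integral>\<^sup>+x. ?g (a - x) \<partial>lborel)"
    by (rule nn_integral_add) measurable
  also have "\<dots> < \<infinity>" unfolding pos neg using fin by simp
  finally show ?thesis .
qed

lemma nn_integral_real2_prod: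
  fixes f g :: "real \<Rightarrow> ennreal"
  assumes [measurable]: "f \<in> borel_measurable borel" "g \<in> borel_measurable borel"
  shows "(\<integral>\<^sup>+y. f (y $ 1) * g (y $ 2) \<partial>(lborel :: (real^2) measure)) = (\<integral>\<^sup>+x. f x \<partial>lborel) * (\<integral>\<^sup>+x. g x \<partial>lborel)"
proof -
  have B: "(Basis :: (real^2) set) = {axis 1 1, axis 2 1}"
    by (auto simp: Basis_vec_def UNIV_2)
  have ne: "axis 1 1 \<noteq> (axis 2 1 :: real^2)" by (simp add: axis_eq_axis)
  define h where "h b = (if b = (axis 1 1 :: real^2) then f else g)" for b
  have "(\<integral>\<^sup>+y. (\<Prod>b\<in>Basis. h b (y \<bullet> b)) \<partial>(lborel :: (real^2) measure)) = (\<Prod>b\<in>Basis. (\<integral>\<^sup>+x. h b x \<partial>lborel))"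
    by (rule nn_integral_lborel_prod) (auto simp: h_def)
  then show ?thesis using ne by (simp add: B h_def inner_axis)
qed

section \<open>Straightening the surface near a mildly degenerate point\<close>

text \<open>For a unit vector n, the first component has derivative 1 along N and 0 along T and
  \<partial>z. If u is a defining function, the common zeros of the other two are the points of the
  critical curve in its domain.\<close>

definition straighten :: "real^2 \<Rightarrow> (real^3 \<Rightarrow> real) \<Rightarrow> real^3 \<Rightarrow> real^3" where
  "straighten n u q = vector [n $ 1 * q $ 1 + n $ 2 * q $ 2, vf_deriv (field_N n) u q, u q]"

lemma smooth_on_straighten:
  assumes "smooth_on U u" shows "smooth_on U (straighten n u)"
proof (rule smooth_on_vec)
  show U: "open U" using assms by (simp add: smooth_on_def)
  have "smooth_on U (\<lambda>q. n $ 1 * q $ 1 + n $ 2 * q $ 2)"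
    by (intro smooth_on_add smooth_on_mult smooth_on_const smooth_on_vec_nth U)
  then show "smooth_on U (\<lambda>q. straighten n u q $ i)" for i
    using exhaust_3[of i] assms smooth_on_vf_deriv_field_N[OF assms, of n]
    by (auto simp: straighten_def)
qed

lemma fd_vec_nth: "f differentiable (at x) \<Longrightarrow> fd (\<lambda>x. f x $ i) x w = fd f x w $ i"
  using frechet_derivative_eqI[OF bounded_linear.has_derivative[OF bounded_linear_vec_nth]]
    frechet_derivative_works by metis

lemma fd_straighten:
  assumes "smooth_on U u" "q \<in> U"
  shows "fd (straighten n u) q w
    = vector [n $ 1 * w $ 1 + n $ 2 * w $ 2, fd (vf_deriv (field_N n) u) q w, fd u q w]"
proof -
  have d: "straighten n u differentiable (at q)"
    using smooth_on_differentiable[OF smooth_on_straighten] assms by blast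
  have "((\<lambda>q. n $ 1 * q $ 1 + n $ 2 * q $ 2) has_derivative (\<lambda>w. n $ 1 * w $ 1 + n $ 2 * w $ 2)) (at q)"
    by (intro has_derivative_add has_derivative_mult_right bounded_linear_imp_has_derivative
        bounded_linear_vec_nth)
  from frechet_derivative_eqI[OF this]
  have "fd (\<lambda>q. n $ 1 * q $ 1 + n $ 2 * q $ 2) q w = n $ 1 * w $ 1 + n $ 2 * w $ 2" by simp
  then show ?thesis
    using fd_vec_nth[OF d, of 1 w] fd_vec_nth[OF d, of 2 w] fd_vec_nth[OF d, of 3 w]
    by (simp add: vec_eq_iff forall_3 straighten_def)
qed

text \<open>X, Y and \<partial>z span the tangent space, and du kills the first two at a
  characteristic point; it cannot kill the third as well.\<close>

lemma characteristic_vertical_deriv_nonzero: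
  assumes ldf: "local_defining_function \<Sigma> p U u" and p: "p \<in> characteristic_set \<Sigma>"
  shows "fd u p (axis 3 1) \<noteq> 0"
proof
  assume 3: "fd u p (axis 3 1) = 0"
  have u: "smooth_on U u" and pU: "p \<in> U" and nz: "fd u p \<noteq> (\<lambda>v. 0)"
    using ldf unfolding local_defining_function_def by blast+
  note d = smooth_on_differentiable[OF u pU]
  have "fd u p (axis 1 1) = 0" "fd u p (axis 2 1) = 0"
    using characteristic_imp_horizontal_deriv_zero[OF ldf p] 3
    unfolding heis_X_eq heis_Y_eq vf_deriv_field_N[OF d] by simp_all
  then have "fd u p v = 0" for v
    using linear_real3_expansion[OF smooth_on_linear_fd[OF u pU], of v] 3 by simp
  then show False using nz by auto
qed

text \<open>The differential is triangular in the frame N, \<partial>z, T: a kernel vector has no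
  N-part by the first component, then no \<partial>z-part by u, because Tu = 0, and finally no
  T-part by Nu, because T(Nu) is nonzero.\<close>

lemma inj_fd_straighten:
  assumes ldf: "local_defining_function \<Sigma> p U u" and p: "p \<in> characteristic_set \<Sigma>"
    and n: "norm n = 1" and hess: "\<And>V. hor_Hess u p n V = 0"
  shows "inj (fd (straighten n u) p)"
proof -
  have u: "smooth_on U u" and pU: "p \<in> U"
    using ldf unfolding local_defining_function_def by blast+
  let ?c = "fd u p (axis 3 1)" and ?F = "vf_deriv (field_N n) u"
  have F: "smooth_on U ?F" by (rule smooth_on_vf_deriv_field_N[OF u])
  have c: "?c \<noteq> 0" by (rule characteristic_vertical_deriv_nonzero[OF ldf p])
  have n1: "n $ 1 * n $ 1 + n $ 2 * n $ 2 = 1" using norm_eq_1_real2[OF n] by (simp add: power2_eq_square)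
  have Tu: "fd u p (field_T n p) = 0"
    using characteristic_imp_horizontal_deriv_zero[OF ldf p]
      vf_deriv_field_N_frame[OF smooth_on_differentiable[OF u pU]]
    by (simp add: field_T_eq vf_deriv_def)
  \<comment> \<open>The hypothesis on n kills the term N(Tu) of the commutator, whose coefficient is
    (n1)^2 + (n2)^2 = 1.\<close>
  have TF: "fd ?F p (field_T n p) = - ?c"
    using field_N_commutator[OF u pU, of n "vector [- (n $ 2), n $ 1]"]
      hess[of "vector [- (n $ 2), n $ 1]"] hor_Hess_eq[OF u pU] n1
    by (simp add: field_T_eq vf_deriv_def[of _ ?F])
  have lin: "linear (fd (straighten n u) p)"
    by (rule smooth_on_linear_fd[OF smooth_on_straighten[OF u] pU])
  show ?thesis
    unfolding linear_injective_0[OF lin]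
  proof (intro allI impI)
    fix w assume "fd (straighten n u) p w = 0"
    then have 0: "n $ 1 * w $ 1 + n $ 2 * w $ 2 = 0" "fd ?F p w = 0" "fd u p w = 0"
      unfolding fd_straighten[OF u pU] by (simp_all add: vec_eq_iff forall_3)
    \<comment> \<open>\<open>\<beta>\<close> is the T-part of w, and \<open>\<zeta>\<close> below is
      the vertical remainder.\<close>
    define \<beta> where "\<beta> = n $ 1 * w $ 2 - n $ 2 * w $ 1"
    define \<zeta> where "\<zeta> = w $ 3 - \<beta> * field_T n p $ 3"
    have "w $ 1 = (n $ 1 * n $ 1 + n $ 2 * n $ 2) * w $ 1" by (simp add: n1)
    also have "\<dots> = n $ 1 * (n $ 1 * w $ 1 + n $ 2 * w $ 2) - n $ 2 * \<beta>"
      by (simp add: \<beta>_def algebra_simps)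
    finally have w1: "w $ 1 = - n $ 2 * \<beta>" by (simp add: 0)
    have "w $ 2 = (n $ 1 * n $ 1 + n $ 2 * n $ 2) * w $ 2" by (simp add: n1)
    also have "\<dots> = n $ 2 * (n $ 1 * w $ 1 + n $ 2 * w $ 2) + n $ 1 * \<beta>"
      by (simp add: \<beta>_def algebra_simps)
    finally have w2: "w $ 2 = n $ 1 * \<beta>" by (simp add: 0)
    have w: "w = \<beta> *\<^sub>R field_T n p + \<zeta> *\<^sub>R axis 3 1"
      by (simp add: vec_eq_iff forall_3 w1 w2 \<zeta>_def field_T_eq field_N_eq axis_def)
    have "\<zeta> * ?c = 0"
      using 0(3) Tu smooth_on_linear_fd[OF u pU] by (subst (asm) w) (simp add: linear_add linear_cmul)
    then have \<zeta>: "\<zeta> = 0" using c by simp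
    have "\<beta> * ?c = 0"
      using 0(2) TF smooth_on_linear_fd[OF F pU] by (subst (asm) w) (simp add: \<zeta> linear_cmul)
    then have "\<beta> = 0" using c by simp
    then show "w = 0" using w \<zeta> by simp
  qed
qed

text \<open>Transfers the finite order of Tu from the parameter of \<gamma> to the first coordinate
  of the straightening. One point q over each \<sigma> is enough: for a \<open>Q\<close> on which
  the straightening is injective, this point is determined by \<sigma>.\<close>

lemma critical_curve_order:
  assumes ldf: "local_defining_function \<Sigma> p U u" and p: "p \<in> characteristic_set \<Sigma>"
    and n: "norm n = 1" and hess: "\<And>V. hor_Hess u p n V = 0"
    and \<gamma>: "regular_parametrization_near (critical_curve \<Sigma> n) p \<epsilon> \<gamma>"
    and k: "(deriv ^^ k) (\<lambda>s. vf_deriv (field_T n) u (\<gamma> s)) 0 \<noteq> 0"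
    and Q: "open Q" "p \<in> Q"
  obtains r c j where "r > 0" "c > 0"
    "\<And>\<sigma>. \<bar>\<sigma> - straighten n u p $ 1\<bar> < r \<Longrightarrow> \<exists>q\<in>Q \<inter> U. straighten n u q = vector [\<sigma>, 0, 0] \<and>
       c * \<bar>\<sigma> - straighten n u p $ 1\<bar> ^ j \<le> \<bar>vf_deriv (field_T n) u q\<bar>"
proof -
  have u: "smooth_on U u" and pU: "p \<in> U" and U: "open U"
    and \<Sigma>: "\<And>q. q \<in> \<Sigma> \<Longrightarrow> q \<in> U \<Longrightarrow> u q = 0"
    using ldf unfolding local_defining_function_def by auto
  note \<gamma> = \<gamma>[unfolded regular_parametrization_near_def]
  let ?I = "{-\<epsilon><..<\<epsilon>}"
  have \<gamma>C: "\<gamma> s \<in> critical_curve \<Sigma> n" if "s \<in> ?I" for s using \<gamma> that by blast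
  have \<epsilon>: "\<epsilon> > 0" "0 \<in> ?I" and \<gamma>0: "\<gamma> 0 = p" and \<gamma>s: "smooth_on ?I \<gamma>"
    using \<gamma> by auto
  have "open (?I \<inter> \<gamma> -` (Q \<inter> U))"
    using smooth_on_continuous_on[OF \<gamma>s] Q U by (intro continuous_open_preimage) auto
  moreover have "0 \<in> ?I \<inter> \<gamma> -` (Q \<inter> U)" using \<epsilon> \<gamma>0 Q pU by auto
  ultimately obtain \<delta>0 where \<delta>0: "\<delta>0 > 0" "ball 0 \<delta>0 \<subseteq> ?I \<inter> \<gamma> -` (Q \<inter> U)" by (meson openE)
  let ?J = "{-\<delta>0<..<\<delta>0}"
  have J: "?J \<subseteq> ?I" "\<And>s. s \<in> ?J \<Longrightarrow> \<gamma> s \<in> Q \<inter> U"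
    using \<delta>0(2) by (auto simp: subset_iff dist_real_def)
  have \<gamma>J: "smooth_on ?J \<gamma>" using smooth_on_subset[OF \<gamma>s J(1)] by simp
  have \<Psi>: "straighten n u (\<gamma> s) = vector [n $ 1 * \<gamma> s $ 1 + n $ 2 * \<gamma> s $ 2, 0, 0]" if "s \<in> ?J" for s
  proof -
    have "\<gamma> s \<in> critical_curve \<Sigma> n" "\<gamma> s \<in> U" using that J \<gamma>C by auto
    moreover from this have "\<gamma> s \<in> \<Sigma>" by (simp add: critical_curve_def)
    ultimately show ?thesis
      using \<Sigma> critical_curve_imp_deriv_zero[OF local_defining_function_move[OF ldf]]
      by (simp add: straighten_def)
  qed
  define m where "m s = straighten n u (\<gamma> s) $ 1" for s
  have sm: "smooth_on ?J (\<lambda>s. straighten n u (\<gamma> s))"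
    by (rule smooth_on_compose[OF smooth_on_straighten[OF u] \<gamma>J]) (use J in auto)
  let ?g' = "fd \<gamma> 0 1"
  have 0: "0 \<in> ?J" using \<delta>0 by simp
  have g': "?g' \<noteq> 0"
  proof -
    have "fd \<gamma> 0 t = t *\<^sub>R ?g'" for t
      using linear_cmul[OF smooth_on_linear_fd[OF \<gamma>J 0], of t 1] by simp
    then have "fd \<gamma> 0 = (\<lambda>t. t *\<^sub>R ?g')" by (rule ext)
    then have "(\<gamma> has_vector_derivative ?g') (at 0)"
      using smooth_on_has_derivative[OF \<gamma>J 0] unfolding has_vector_derivative_def by metis
    then have "vector_derivative \<gamma> (at 0) = ?g'" by (rule vector_derivative_at)
    then show ?thesis using \<gamma> \<epsilon> by auto
  qed
  have dm: "((\<lambda>s. straighten n u (\<gamma> s)) has_derivative (\<lambda>t. fd (straighten n u) p (fd \<gamma> 0 t))) (at 0)"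
    using diff_chain_at[OF smooth_on_has_derivative[OF \<gamma>J 0], of "straighten n u"]
      smooth_on_has_derivative[OF smooth_on_straighten[OF u] pU] by (simp add: \<gamma>0 o_def)
  define m' where "m' = fd (straighten n u) p ?g' $ 1"
  have dmi: "((\<lambda>s. straighten n u (\<gamma> s) $ i) has_real_derivative fd (straighten n u) p ?g' $ i) (at 0)" for i
  proof -
    have "(\<lambda>t. fd (straighten n u) p (fd \<gamma> 0 t) $ i) = (*) (fd (straighten n u) p ?g' $ i)"
    proof
      fix t
      have "fd \<gamma> 0 t = t *\<^sub>R ?g'"
        using linear_cmul[OF smooth_on_linear_fd[OF \<gamma>J 0], of t 1] by simp
      then show "fd (straighten n u) p (fd \<gamma> 0 t) $ i = fd (straighten n u) p ?g' $ i * t"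
        using linear_cmul[OF smooth_on_linear_fd[OF smooth_on_straighten[OF u] pU]] by simp
    qed
    then show ?thesis
      using bounded_linear.has_derivative[OF bounded_linear_vec_nth dm, of i]
      by (simp only: has_field_derivative_def)
  qed
  \<comment> \<open>The curve is mapped into the first axis, so the image of its velocity has no
    other components.\<close>
  have z: "fd (straighten n u) p ?g' $ i = 0" if i: "i = 2 \<or> i = 3" for i
  proof -
    have "((\<lambda>s. 0) has_real_derivative fd (straighten n u) p ?g' $ i) (at 0)"
      by (rule DERIV_cong_ev[THEN iffD1, OF refl _ refl dmi[of i]])
        (use \<Psi> i 0 in \<open>auto simp: eventually_nhds intro!: exI[of _ ?J]\<close>)
    then show ?thesis using DERIV_unique DERIV_const by blast
  qed
  \<comment> \<open>Otherwise the injective differential of the straightening would annihilate the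
    nonzero velocity of \<gamma>.\<close>
  have m': "m' \<noteq> 0"
  proof
    assume "m' = 0"
    then have "fd (straighten n u) p ?g' = 0"
      using z by (simp add: vec_eq_iff forall_3 m'_def)
    then show False
      using inj_fd_straighten[OF ldf p n hess] g'
        linear_injective_0[OF smooth_on_linear_fd[OF smooth_on_straighten[OF u] pU]] by blast
  qed
  let ?f = "\<lambda>s. vf_deriv (field_T n) u (\<gamma> s)"
  have "smooth_on ?J ?f"
    unfolding field_T_eq
    by (rule smooth_on_compose[OF smooth_on_vf_deriv_field_N[OF u] \<gamma>J]) (use J in auto)
  then obtain j c \<delta> where c: "c > 0" "0 < \<delta>" "\<delta> \<le> \<delta>0"
    and f: "\<And>s. \<bar>s\<bar> < \<delta> \<Longrightarrow> c * \<bar>s\<bar> ^ j \<le> \<bar>?f s\<bar>"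
    using smooth_finite_order_zero_lower_bound[OF _ \<delta>0(1) k] by metis
  have dm1: "(m has_real_derivative m') (at 0)"
    using dmi[of 1] by (simp add: m_def[abs_def] m'_def)
  have "continuous_on {-\<delta><..<\<delta>} m"
    unfolding m_def using c(3)
    by (intro continuous_on_component continuous_on_subset[OF smooth_on_continuous_on[OF sm]]) auto
  then obtain r where r: "r > 0"
    "\<And>\<sigma>. \<bar>\<sigma> - m 0\<bar> < r \<Longrightarrow> \<exists>s. \<bar>s\<bar> < \<delta> \<and> m s = \<sigma> \<and> \<bar>\<sigma> - m 0\<bar> \<le> 2 * \<bar>m'\<bar> * \<bar>s\<bar>"
    using real_local_preimage_bound[OF dm1 m' _ c(2)] by blast
  show thesis
  proof
    show "r > 0" by fact
    \<comment> \<open>This constant results from inserting \<bar>\<sigma> - m 0\<bar> \<le> 2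
      \<bar>m'\<bar> \<bar>s\<bar> into the bound c \<bar>s\<bar>^j.\<close>
    show "c / (2 * \<bar>m'\<bar>) ^ j > 0" using c m' by simp
    fix \<sigma> assume "\<bar>\<sigma> - straighten n u p $ 1\<bar> < r"
    then obtain s where s: "\<bar>s\<bar> < \<delta>" "m s = \<sigma>" "\<bar>\<sigma> - m 0\<bar> \<le> 2 * \<bar>m'\<bar> * \<bar>s\<bar>"
      using r(2)[of \<sigma>] by (auto simp: m_def \<gamma>0)
    have sJ: "s \<in> ?J" using s(1) c(3) by auto
    have "\<bar>\<sigma> - m 0\<bar> ^ j \<le> (2 * \<bar>m'\<bar> * \<bar>s\<bar>) ^ j" using s(3) by (intro power_mono) auto
    then have "c / (2 * \<bar>m'\<bar>) ^ j * \<bar>\<sigma> - m 0\<bar> ^ j \<le> c / (2 * \<bar>m'\<bar>) ^ j * (2 * \<bar>m'\<bar> * \<bar>s\<bar>) ^ j"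
      using c(1) by (intro mult_left_mono) auto
    also have "\<dots> = c * \<bar>s\<bar> ^ j" using m' by (simp add: power_mult_distrib)
    also have "\<dots> \<le> \<bar>?f s\<bar>" by (rule f[OF s(1)])
    finally have "c / (2 * \<bar>m'\<bar>) ^ j * \<bar>\<sigma> - straighten n u p $ 1\<bar> ^ j \<le> \<bar>?f s\<bar>"
      by (simp add: m_def \<gamma>0)
    moreover have "straighten n u (\<gamma> s) = vector [\<sigma>, 0, 0]"
      using \<Psi>[OF sJ] s(2) by (simp add: m_def)
    ultimately show "\<exists>q\<in>Q \<inter> U. straighten n u q = vector [\<sigma>, 0, 0] \<and>
       c / (2 * \<bar>m'\<bar>) ^ j * \<bar>\<sigma> - straighten n u p $ 1\<bar> ^ j \<le> \<bar>vf_deriv (field_T n) u q\<bar>"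
      using J(2)[OF sJ] by blast
  qed
qed

section \<open>A chart of the surface in straightened coordinates\<close>

lemma continuous_on_compact_bound:
  fixes f :: "'a::topological_space \<Rightarrow> 'b::real_normed_vector"
  assumes "continuous_on S f" "compact K" "K \<subseteq> S"
  obtains B where "B > 0" "\<And>x. x \<in> K \<Longrightarrow> norm (f x) \<le> B"
proof -
  have "bounded (f ` K)"
    using assms continuous_on_subset compact_continuous_image compact_imp_bounded by blast
  then show thesis using that unfolding bounded_pos by auto
qed

lemma bounded_linear_real2_to_plane: "bounded_linear (\<lambda>y::real^2. vector [y $ 1, y $ 2, 0] :: real^3)"
  by (rule linear_conv_bounded_linear[THEN iffD1], rule linearI) (simp_all add: vec_eq_iff forall_3)

lemma open_real2_box: "open {y :: real^2. \<bar>y $ 1 - a\<bar> < r \<and> \<bar>y $ 2\<bar> < s}"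
  by (intro open_Collect_conj open_Collect_less continuous_intros)

lemma open_real3_box: "open {y :: real^3. \<bar>y $ 1 - a\<bar> < r \<and> \<bar>y $ 2\<bar> < s \<and> \<bar>y $ 3\<bar> < t}"
  by (intro open_Collect_conj open_Collect_less continuous_intros)

text \<open>The chart is the inverse of the straightening restricted to the plane where the third
  coordinate u vanishes; the second coordinate is then Nu itself. The bounds on the partial
  derivatives serve the density, those on the horizontal gradient the integrand.\<close>

lemma straightened_chart:
  assumes ldf: "local_defining_function \<Sigma> p U u" and p: "p \<in> characteristic_set \<Sigma>"
    and n: "norm n = 1" and hess: "\<And>V. hor_Hess u p n V = 0"
    and \<gamma>: "regular_parametrization_near (critical_curve \<Sigma> n) p \<epsilon> \<gamma>"
    and k: "(deriv ^^ k) (\<lambda>s. vf_deriv (field_T n) u (\<gamma> s)) 0 \<noteq> 0"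
    and Q: "open Q" "p \<in> Q"
  obtains W D \<phi> a r c j B where "open W" "p \<in> W" "W \<subseteq> Q \<inter> U"
    "D = {y :: real^2. \<bar>y $ 1 - a\<bar> < r \<and> \<bar>y $ 2\<bar> < r}"
    "surface_chart \<Sigma> D \<phi>" "\<phi> ` D = \<Sigma> \<inter> W" "c > 0"
    "\<And>y. y \<in> D \<Longrightarrow> norm (fd \<phi> y (axis 1 1)) \<le> B" "\<And>y. y \<in> D \<Longrightarrow> norm (fd \<phi> y (axis 2 1)) \<le> B"
    "\<And>y. y \<in> D \<Longrightarrow> \<bar>y $ 2\<bar> \<le> hor_grad_norm u (\<phi> y)"
    "\<And>y. y \<in> D \<Longrightarrow> c * \<bar>y $ 1 - a\<bar> ^ j \<le> hor_grad_norm u (\<phi> y)"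
proof -
  let ?\<Psi> = "straighten n u" and ?E = "vf_deriv (field_T n) u"
  have u: "smooth_on U u" and pU: "p \<in> U" and pS: "p \<in> \<Sigma>" and U: "open U"
    and \<Sigma>: "\<And>q. q \<in> U \<Longrightarrow> q \<in> \<Sigma> \<longleftrightarrow> u q = 0"
    using ldf unfolding local_defining_function_def by auto
  note s\<Psi> = smooth_on_straighten[OF u, of n]
  obtain U\<^sub>1 V g where U1: "open U\<^sub>1" "U\<^sub>1 \<subseteq> U" "p \<in> U\<^sub>1" and V: "open V" "?\<Psi> p \<in> V"
    and hom: "homeomorphism U\<^sub>1 V ?\<Psi> g" and g: "smooth_on V g"
    using smooth_inverse_function[OF s\<Psi> pU inj_fd_straighten[OF ldf p n hess]] .
  have g\<Psi>: "\<And>q. q \<in> U\<^sub>1 \<Longrightarrow> g (?\<Psi> q) = q" and \<Psi>g: "\<And>y. y \<in> V \<Longrightarrow> ?\<Psi> (g y) = y"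
    and gV: "\<And>y. y \<in> V \<Longrightarrow> g y \<in> U\<^sub>1"
    using hom unfolding homeomorphism_def by auto
  define a where "a = ?\<Psi> p $ 1"
  have \<Psi>p: "?\<Psi> p $ 2 = 0" "?\<Psi> p $ 3 = 0"
    using characteristic_imp_horizontal_deriv_zero[OF ldf p] \<Sigma>[OF pU] pS
      vf_deriv_field_N_frame[OF smooth_on_differentiable[OF u pU]]
    by (simp_all add: straighten_def)
  have "open (V \<inter> g -` Q)"
    using smooth_on_continuous_on[OF g] V(1) Q(1) by (rule continuous_open_preimage)
  moreover have "?\<Psi> p \<in> V \<inter> g -` Q" using V g\<Psi>[OF U1(3)] Q by simp
  ultimately obtain \<rho> where \<rho>: "\<rho> > 0" "ball (?\<Psi> p) \<rho> \<subseteq> V \<inter> g -` Q" by (meson openE)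
  \<comment> \<open>A compact set inside the domain of the inverse, on which the derivatives of the
    inverse and of Tu are bounded.\<close>
  define K where "K = cball (?\<Psi> p) (\<rho> / 2)"
  have "K \<subseteq> ball (?\<Psi> p) \<rho>" using \<rho>(1) by (auto simp: K_def)
  then have K: "K \<subseteq> V" "\<And>y. y \<in> K \<Longrightarrow> g y \<in> Q" "compact K" using \<rho> by (auto simp: K_def)
  have sE: "smooth_on U ?E" unfolding field_T_eq by (rule smooth_on_vf_deriv_field_N[OF u])
  have sEg: "smooth_on V (\<lambda>y. ?E (g y))"
    by (rule smooth_on_compose[OF sE g]) (use gV U1 in auto)
  obtain B\<^sub>1 where B1: "B\<^sub>1 > 0" "\<And>y. y \<in> K \<Longrightarrow> norm (fd g y (axis 1 1)) \<le> B\<^sub>1"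
    using continuous_on_compact_bound[OF smooth_on_continuous_on[OF smooth_on_frechet_derivative[OF g, of "axis 1 1"]] K(3,1)] by blast
  obtain B\<^sub>2 where B2: "B\<^sub>2 > 0" "\<And>y. y \<in> K \<Longrightarrow> norm (fd g y (axis 2 1)) \<le> B\<^sub>2"
    using continuous_on_compact_bound[OF smooth_on_continuous_on[OF smooth_on_frechet_derivative[OF g, of "axis 2 1"]] K(3,1)] by blast
  obtain L where L: "L > 0" "\<And>y. y \<in> K \<Longrightarrow> norm (fd (\<lambda>y. ?E (g y)) y (axis 2 1)) \<le> L"
    using continuous_on_compact_bound[OF smooth_on_continuous_on[OF smooth_on_frechet_derivative[OF sEg, of "axis 2 1"]] K(3,1)] by blast
  have Q1: "open (Q \<inter> U\<^sub>1)" "p \<in> Q \<inter> U\<^sub>1" using Q U1 by auto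
  obtain r1 c1 j where r1: "r1 > 0" and c1: "c1 > 0"
    and curve: "\<And>\<sigma>. \<bar>\<sigma> - a\<bar> < r1 \<Longrightarrow> \<exists>q\<in>Q \<inter> U\<^sub>1 \<inter> U. ?\<Psi> q = vector [\<sigma>, 0, 0] \<and> c1 * \<bar>\<sigma> - a\<bar> ^ j \<le> \<bar>?E q\<bar>"
    unfolding a_def using critical_curve_order[OF ldf p n hess \<gamma> k Q1] by blast
  \<comment> \<open>The distance of a point of the box from the centre is at most 3 r \<le> \<rho> /
    2, so the box lies in \<open>K\<close>.\<close>
  define r where "r = min r1 (\<rho> / 6)"
  have r: "r > 0" "r \<le> r1" "r \<le> \<rho> / 6" using r1 \<rho> by (auto simp: r_def)
  define box where "box = {y :: real^3. \<bar>y $ 1 - a\<bar> < r \<and> \<bar>y $ 2\<bar> < r \<and> \<bar>y $ 3\<bar> < r}"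
  define D where "D = {y :: real^2. \<bar>y $ 1 - a\<bar> < r \<and> \<bar>y $ 2\<bar> < r}"
  define \<iota> where "\<iota> y = (vector [y $ 1, y $ 2, 0] :: real^3)" for y :: "real^2"
  define \<phi> where "\<phi> y = g (\<iota> y)" for y
  define W where "W = {q \<in> U\<^sub>1. ?\<Psi> q \<in> box}"
  have boxK: "y \<in> K" if "y \<in> box" for y
  proof -
    have "norm (y - ?\<Psi> p) \<le> (\<Sum>i\<in>UNIV. \<bar>(y - ?\<Psi> p) $ i\<bar>)" by (rule norm_le_l1_cart)
    also have "\<dots> = \<bar>y $ 1 - a\<bar> + \<bar>y $ 2\<bar> + \<bar>y $ 3\<bar>" by (simp add: sum_3 \<Psi>p a_def)
    also have "\<dots> \<le> \<rho> / 2" using that r by (simp add: box_def)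
    finally show ?thesis by (simp add: K_def dist_norm norm_minus_commute)
  qed
  have \<iota>box: "\<iota> y \<in> box" if "y \<in> D" for y using that r by (simp add: \<iota>_def box_def D_def)
  have \<iota>K: "\<iota> y \<in> K" and \<iota>V: "\<iota> y \<in> V" if "y \<in> D" for y
    using boxK[OF \<iota>box[OF that]] K(1) by auto
  have \<phi>U1: "\<phi> y \<in> U\<^sub>1" and \<Psi>\<phi>: "?\<Psi> (\<phi> y) = \<iota> y" if "y \<in> D" for y
    using gV[OF \<iota>V[OF that]] \<Psi>g[OF \<iota>V[OF that]] by (simp_all add: \<phi>_def)
  have \<phi>U: "\<phi> y \<in> U" if "y \<in> D" for y using \<phi>U1[OF that] U1 by auto
  have D: "open D" unfolding D_def by (rule open_real2_box)
  have \<iota>: "bounded_linear \<iota>" unfolding \<iota>_def[abs_def] by (rule bounded_linear_real2_to_plane)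
  have \<phi>: "smooth_on D \<phi>"
    unfolding \<phi>_def[abs_def]
    by (rule smooth_on_compose[OF g smooth_on_linear[OF D \<iota>]]) (use \<iota>V in auto)
  have fd\<phi>: "fd \<phi> y v = fd g (\<iota> y) (\<iota> v)" if "y \<in> D" for y v
    using frechet_derivative_eqI[OF diff_chain_at[OF bounded_linear_imp_has_derivative[OF \<iota>]
        smooth_on_has_derivative[OF g \<iota>V[OF that]]]] by (simp add: \<phi>_def[abs_def] o_def)
  have \<iota>inj: "\<iota> y = \<iota> y' \<Longrightarrow> y = y'" for y y'
    by (simp add: \<iota>_def vec_eq_iff forall_3 forall_2)
  have chart: "surface_chart \<Sigma> D \<phi>"
    unfolding surface_chart_def
  proof (intro conjI D \<phi> ballI)
    show "inj_on \<phi> D" by (rule inj_onI) (metis \<Psi>\<phi> \<iota>inj)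
    show "\<phi> ` D \<subseteq> \<Sigma>"
    proof
      fix q assume "q \<in> \<phi> ` D"
      then obtain y where y: "y \<in> D" "q = \<phi> y" by blast
      have "u q = ?\<Psi> q $ 3" by (simp add: straighten_def)
      also have "\<dots> = 0" by (simp add: \<Psi>\<phi> y \<iota>_def)
      finally show "q \<in> \<Sigma>" using \<Sigma> \<phi>U y by blast
    qed
    fix y assume y: "y \<in> D"
    \<comment> \<open>Differentiating \<Psi> \<circ> g = id exhibits a left inverse of the
      differential of g.\<close>
    have "((\<lambda>z. ?\<Psi> (g z)) has_derivative (\<lambda>v. fd ?\<Psi> (g (\<iota> y)) (fd g (\<iota> y) v))) (at (\<iota> y))"
      using diff_chain_at[OF smooth_on_has_derivative[OF g \<iota>V[OF y]]
          smooth_on_has_derivative[OF s\<Psi>, of "g (\<iota> y)"]] \<phi>U[OF y] by (simp add: o_def \<phi>_def)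
    then have "((\<lambda>z. z) has_derivative (\<lambda>v. fd ?\<Psi> (g (\<iota> y)) (fd g (\<iota> y) v))) (at (\<iota> y))"
      by (rule has_derivative_transform_within_open[OF _ V(1) \<iota>V[OF y]]) (rule \<Psi>g)
    from frechet_derivative_eqI[OF this]
    have inv: "fd ?\<Psi> (g (\<iota> y)) (fd g (\<iota> y) v) = v" for v by (simp add: fun_eq_iff)
    show "inj (fd \<phi> y)"
      by (rule injI) (metis inv fd\<phi>[OF y] \<iota>inj)
  qed
  \<comment> \<open>The bound on Tu holds at the point of the critical curve with the same first
    coordinate. Moving off the curve changes Tu by at most L \<bar>y2\<bar>, and \<bar>y2\<bar> =
    \<bar>Nu\<bar> is itself at most the gradient norm; hence the factor 1 + L.\<close>
  have E_lower: "c1 * \<bar>y $ 1 - a\<bar> ^ j \<le> (1 + L) * hor_grad_norm u (\<phi> y)"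
    and F_lower: "\<bar>y $ 2\<bar> \<le> hor_grad_norm u (\<phi> y)" if y: "y \<in> D" for y
  proof -
    note d = smooth_on_differentiable[OF u \<phi>U[OF y]]
    have "vf_deriv (field_N n) u (\<phi> y) = ?\<Psi> (\<phi> y) $ 2" by (simp add: straighten_def)
    also have "\<dots> = y $ 2" by (simp add: \<Psi>\<phi>[OF y] \<iota>_def)
    finally show F: "\<bar>y $ 2\<bar> \<le> hor_grad_norm u (\<phi> y)" using hor_grad_norm_ge(1)[OF d n] by simp
    \<comment> \<open>The segment parallel to the second axis that starts on the curve at t = 0 and
      reaches the given point at t = y2.\<close>
    define z where "z t = (vector [y $ 1, 0, 0] :: real^3) + t *\<^sub>R axis 2 1" for t
    have z: "z (y $ 2) = \<iota> y" by (simp add: z_def \<iota>_def vec_eq_iff forall_3 axis_def)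
    have zbox: "z t \<in> box" if "t \<in> {-r<..<r}" for t
      using that y r by (auto simp: z_def box_def D_def axis_def)
    have "norm (?E (g (z (y $ 2))) - ?E (g (z 0))) \<le> L * norm (y $ 2 - 0)"
    proof (rule field_differentiable_bound[of "{-r<..<r}"])
      fix t assume "t \<in> {-r<..<r}"
      note zK = boxK[OF zbox[OF this]]
      show "((\<lambda>t. ?E (g (z t))) has_field_derivative fd (\<lambda>y. ?E (g y)) (z t) (axis 2 1)) (at t within {-r<..<r})"
        unfolding z_def by (rule has_field_derivative_at_within[OF smooth_on_line_has_derivative[OF sEg]])
          (use zK K(1) in \<open>auto simp: z_def\<close>)
      show "norm (fd (\<lambda>y. ?E (g y)) (z t) (axis 2 1)) \<le> L" by (rule L(2)[OF zK])
    qed (use y r in \<open>auto simp: D_def\<close>)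
    then have lip: "\<bar>?E (\<phi> y) - ?E (g (z 0))\<bar> \<le> L * \<bar>y $ 2\<bar>" by (simp add: z \<phi>_def)
    have "\<bar>y $ 1 - a\<bar> < r1" using y r by (simp add: D_def)
    from curve[OF this] obtain q where q: "q \<in> U\<^sub>1" "?\<Psi> q = vector [y $ 1, 0, 0]"
      "c1 * \<bar>y $ 1 - a\<bar> ^ j \<le> \<bar>?E q\<bar>" by blast
    \<comment> \<open>Injectivity of the straightening on \<open>U\<^sub>1\<close> identifies the
      point supplied by \<open>curve\<close> with the start of the segment.\<close>
    have g0: "g (z 0) = q" using g\<Psi>[OF q(1)] q(2) by (simp add: z_def)
    have "c1 * \<bar>y $ 1 - a\<bar> ^ j \<le> \<bar>?E (\<phi> y)\<bar> + L * \<bar>y $ 2\<bar>"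
      using q(3) lip[unfolded g0] by argo
    also have "\<dots> \<le> hor_grad_norm u (\<phi> y) + L * hor_grad_norm u (\<phi> y)"
      using hor_grad_norm_ge(2)[OF d n] F L(1) by (intro add_mono mult_left_mono) auto
    finally show "c1 * \<bar>y $ 1 - a\<bar> ^ j \<le> (1 + L) * hor_grad_norm u (\<phi> y)" by (simp add: algebra_simps)
  qed
  show thesis
  proof
    have "W = U\<^sub>1 \<inter> ?\<Psi> -` box" by (auto simp: W_def)
    then show "open W"
      using continuous_open_preimage[OF continuous_on_subset[OF smooth_on_continuous_on[OF s\<Psi>] U1(2)] U1(1)
          open_real3_box] by (simp add: box_def)
    show "p \<in> W" using U1 r \<Psi>p by (simp add: W_def box_def a_def)
    show "W \<subseteq> Q \<inter> U"
    proof
      fix q assume q: "q \<in> W"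
      then have "g (?\<Psi> q) \<in> Q" using boxK K(2) by (simp add: W_def)
      then show "q \<in> Q \<inter> U" using q U1 g\<Psi> by (auto simp: W_def)
    qed
    show "D = {y :: real^2. \<bar>y $ 1 - a\<bar> < r \<and> \<bar>y $ 2\<bar> < r}" by (rule D_def)
    show "surface_chart \<Sigma> D \<phi>" by (rule chart)
    show "\<phi> ` D = \<Sigma> \<inter> W"
    proof (intro equalityI subsetI)
      fix q assume "q \<in> \<phi> ` D"
      then show "q \<in> \<Sigma> \<inter> W"
        using chart \<phi>U1 \<Psi>\<phi> \<iota>box by (auto simp: surface_chart_def W_def)
    next
      fix q assume q: "q \<in> \<Sigma> \<inter> W"
      then have q1: "q \<in> U\<^sub>1" "?\<Psi> q \<in> box" by (auto simp: W_def)
      then have "?\<Psi> q $ 3 = 0" using \<Sigma> q U1 by (auto simp: straighten_def)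
      then have "\<iota> (vector [?\<Psi> q $ 1, ?\<Psi> q $ 2]) = ?\<Psi> q" by (simp add: \<iota>_def vec_eq_iff forall_3)
      then have "q = \<phi> (vector [?\<Psi> q $ 1, ?\<Psi> q $ 2])" using g\<Psi>[OF q1(1)] by (simp add: \<phi>_def)
      moreover have "vector [?\<Psi> q $ 1, ?\<Psi> q $ 2] \<in> D" using q1(2) by (simp add: D_def box_def)
      ultimately show "q \<in> \<phi> ` D" by blast
    qed
    show "c1 / (1 + L) > 0" using c1 L by simp
    have \<iota>a: "\<iota> (axis 1 1) = axis 1 1" "\<iota> (axis 2 1) = axis 2 1"
      by (simp_all add: \<iota>_def vec_eq_iff forall_3 axis_def)
    fix y assume y: "y \<in> D"
    show "norm (fd \<phi> y (axis 1 1)) \<le> max B\<^sub>1 B\<^sub>2" "norm (fd \<phi> y (axis 2 1)) \<le> max B\<^sub>1 B\<^sub>2"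
      using B1(2)[OF \<iota>K[OF y]] B2(2)[OF \<iota>K[OF y]] by (auto simp: fd\<phi>[OF y] \<iota>a)
    show "\<bar>y $ 2\<bar> \<le> hor_grad_norm u (\<phi> y)" by (rule F_lower[OF y])
    show "c1 / (1 + L) * \<bar>y $ 1 - a\<bar> ^ j \<le> hor_grad_norm u (\<phi> y)"
      using E_lower[OF y] L(1) by (simp add: field_simps)
  qed
qed

section \<open>The induced measure\<close>

text \<open>The choice in \<open>unit_normal\<close> is meaningful only if a candidate exists. It is
  the G-gradient of u divided by its length: positive definiteness of G lets a vector m represent
  du, and m is then G-orthogonal to the kernel of du.\<close>

lemma unit_normal_unit:
  assumes G: "riemannian_metric G" and ldf: "local_defining_function \<Sigma> q U u"
  shows "G q (unit_normal G \<Sigma> q) (unit_normal G \<Sigma> q) = 1"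
proof -
  have bl: "bilinear (G q)" and pos: "\<And>v. v \<noteq> 0 \<Longrightarrow> G q v v > 0"
    using G unfolding riemannian_metric_def by blast+
  have u: "linear (fd u q)" and nz: "fd u q \<noteq> (\<lambda>v. 0)"
    using ldf smooth_on_linear_fd unfolding local_defining_function_def by blast+
  define L where "L m = (\<chi> i. G q m (axis i 1))" for m
  have L: "linear L"
    by (rule linearI)
      (simp_all add: L_def vec_eq_iff bilinear_ladd[OF bl] bilinear_lmul[OF bl])
  have G_eq: "G q m v = v $ 1 * L m $ 1 + v $ 2 * L m $ 2 + v $ 3 * L m $ 3" for m v
    using linear_real3_expansion[of "G q m" v] bl by (simp add: L_def bilinear_def)
  have "inj L"
    unfolding linear_injective_0[OF L]
  proof (intro allI impI)
    fix m assume "L m = 0"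
    then have "G q m m = 0" by (simp add: G_eq)
    then show "m = 0" using pos[of m] by fastforce
  qed
  then have "surj L" using linear_injective_imp_surjective[OF L] by blast
  then obtain m where m: "L m = (\<chi> i. fd u q (axis i 1))" by (metis surjD)
  have Gm: "G q m v = fd u q v" for v
    using linear_real3_expansion[OF u, of v] by (simp add: G_eq m)
  have "m \<noteq> 0" using nz Gm bilinear_lzero[OF bl] by (metis ext)
  then have Gmm: "G q m m > 0" by (rule pos)
  define m' where "m' = (1 / sqrt (G q m m)) *\<^sub>R m"
  have "G q m' m' = 1" and "\<forall>v\<in>tangent_plane \<Sigma> q. G q m' v = 0"
    using Gmm by (simp_all add: m'_def bilinear_lmul[OF bl] bilinear_rmul[OF bl] tangent_plane_eq[OF ldf] Gm)
  then have "\<exists>m. G q m m = 1 \<and> (\<forall>v\<in>tangent_plane \<Sigma> q. G q m v = 0)" by blast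
  from someI_ex[OF this] show ?thesis by (simp add: unit_normal_def)
qed

text \<open>G(v, v) attains a positive minimum m on K times the unit sphere, and homogeneity turns
  G(v, v) = 1 into a bound on the Euclidean norm.\<close>

lemma riemannian_metric_unit_bound:
  assumes G: "riemannian_metric G" and K: "compact K"
  obtains C where "C > 0" "\<And>q v. q \<in> K \<Longrightarrow> G q v v = 1 \<Longrightarrow> norm v \<le> C"
proof (cases "K = {}")
  case False
  have bl: "bilinear (G q)" and pos: "\<And>v. v \<noteq> 0 \<Longrightarrow> G q v v > 0"
    and sm: "\<And>v w. smooth_on UNIV (\<lambda>q. G q v w)" for q
    using G unfolding riemannian_metric_def by blast+
  let ?S = "K \<times> sphere (0 :: real^3) 1"
  \<comment> \<open>Smoothness of G is given for fixed arguments; the expansion in the basis yields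
    joint continuity in q and v.\<close>
  have exp: "G q v v = (\<Sum>b\<in>Basis. \<Sum>b'\<in>Basis. (v \<bullet> b) * (v \<bullet> b') * G q b b')" for q v
  proof -
    have "G q (\<Sum>b\<in>Basis. (v \<bullet> b) *\<^sub>R b) (\<Sum>b\<in>Basis. (v \<bullet> b) *\<^sub>R b)
        = (\<Sum>b\<in>Basis. \<Sum>b'\<in>Basis. (v \<bullet> b) * (v \<bullet> b') * G q b b')"
      by (simp add: bilinear_sum[OF bl] bilinear_lmul[OF bl] bilinear_rmul[OF bl]
          sum.cartesian_product mult_ac split_def)
    then show ?thesis by (simp add: euclidean_representation)
  qed
  have "continuous_on ?S (\<lambda>x. \<Sum>b\<in>Basis. \<Sum>b'\<in>Basis. (snd x \<bullet> b) * (snd x \<bullet> b') * G (fst x) b b')"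
    by (intro continuous_intros continuous_on_compose2[OF smooth_on_continuous_on[OF sm]]) auto
  then have c: "continuous_on ?S (\<lambda>x. G (fst x) (snd x) (snd x))" by (simp only: exp[symmetric])
  have "compact ?S" "?S \<noteq> {}" using K False by (auto intro: compact_Times)
  from continuous_attains_inf[OF this c] obtain q0 v0 where
    qv: "q0 \<in> K" "norm v0 = 1" "\<And>q v. q \<in> K \<Longrightarrow> norm v = 1 \<Longrightarrow> G q0 v0 v0 \<le> G q v v"
    by force
  define m where "m = G q0 v0 v0"
  have "v0 \<noteq> 0" using qv(2) by auto
  then have m: "m > 0" unfolding m_def by (rule pos)
  show thesis
  proof
    \<comment> \<open>The maximum avoids a square root: if norm v > 1, then m * norm v is at most m
      times the square of norm v, hence at most 1.\<close>
    show "max 1 (1 / m) > 0" by simp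
    fix q v assume q: "q \<in> K" and v: "G q v v = 1"
    show "norm v \<le> max 1 (1 / m)"
    proof (cases "norm v \<le> 1")
      case False
      then have nv: "norm v > 1" by simp
      define w where "w = (1 / norm v) *\<^sub>R v"
      have "norm w = 1" using nv by (auto simp: w_def)
      then have "m \<le> G q w w" unfolding m_def by (rule qv(3)[OF q])
      also have "\<dots> = 1 / (norm v * norm v)"
        using v by (simp add: w_def bilinear_lmul[OF bl] bilinear_rmul[OF bl])
      finally have "m \<le> 1 / (norm v * norm v)" .
      moreover have "norm v * norm v > 0" using nv by (intro mult_pos_pos) auto
      ultimately have "m * (norm v * norm v) \<le> 1" by (simp add: pos_le_divide_eq)
      moreover have "m * (norm v * 1) \<le> m * (norm v * norm v)"
        using m nv by (intro mult_left_mono) auto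
      ultimately have "m * norm v \<le> 1" by linarith
      then have "norm v \<le> 1 / m" using m by (simp add: field_simps)
      then show ?thesis by simp
    qed simp
  qed
qed (use that[of 1] in auto)

text \<open>The Leibniz formula has six terms.\<close>

lemma abs_det_3_le:
  fixes x y z :: "real^3"
  assumes "norm x \<le> A" "norm y \<le> B" "norm z \<le> B"
  shows "\<bar>det (vector [x, y, z] :: real^3^3)\<bar> \<le> 6 * (A * B * B)"
proof -
  have t: "\<bar>x $ i * y $ j * z $ l\<bar> \<le> A * B * B" for i j l
  proof -
    have "\<bar>x $ i\<bar> \<le> A" "\<bar>y $ j\<bar> \<le> B" "\<bar>z $ l\<bar> \<le> B"
      using assms component_le_norm_cart order_trans by blast+
    then show ?thesis unfolding abs_mult by (intro mult_mono) (auto intro: order_trans[OF abs_ge_zero])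
  qed
  show ?thesis
    unfolding det_3 vector_3
    using t[of 1 2 3] t[of 2 3 1] t[of 3 1 2] t[of 1 3 2] t[of 2 1 3] t[of 3 2 1] by linarith
qed

text \<open>The defining property of \<sigma> concerns measures of sets only. It bounds the
  restriction of \<sigma> to the chart by K times the pushforward of Lebesgue measure, and this
  inequality of measures passes to integrals.\<close>

lemma nn_integral_induced_measure_le:
  fixes f :: "real^3 \<Rightarrow> ennreal"
  assumes \<sigma>: "riemannian_induced_measure G \<Sigma> \<sigma>" and chart: "surface_chart \<Sigma> D \<phi>"
    and K: "\<And>s. s \<in> D \<Longrightarrow> induced_density G \<Sigma> (\<phi> s) (fd \<phi> s (axis 1 1)) (fd \<phi> s (axis 2 1)) \<le> K"
    and W: "open W" "\<phi> ` D = \<Sigma> \<inter> W" and f: "f \<in> borel_measurable borel"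
  shows "(\<integral>\<^sup>+q\<in>\<Sigma> \<inter> W. f q \<partial>\<sigma>) \<le> ennreal K * (\<integral>\<^sup>+s\<in>D. f (\<phi> s) \<partial>lborel)"
proof -
  have sp: "space \<sigma> = \<Sigma>" and se: "sets \<sigma> = sets (restrict_space borel \<Sigma>)"
    and em: "\<And>A. A \<in> sets \<sigma> \<Longrightarrow> A \<subseteq> \<phi> ` D \<Longrightarrow> emeasure \<sigma> A =
          (\<integral>\<^sup>+s\<in>{s\<in>D. \<phi> s \<in> A}. ennreal (induced_density G \<Sigma> (\<phi> s) (fd \<phi> s (axis 1 1)) (fd \<phi> s (axis 2 1)))
           \<partial>lborel)"
    using \<sigma> chart unfolding riemannian_induced_measure_def by blast+
  have D: "open D" and \<phi>: "continuous_on D \<phi>"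
    using chart smooth_on_continuous_on unfolding surface_chart_def by blast+
  define R where "R = restrict_space \<sigma> (\<Sigma> \<inter> W)"
  define N where "N = scale_measure (ennreal K) (distr (restrict_space lborel D) R \<phi>)"
  have \<Sigma>W: "\<Sigma> \<inter> W \<in> sets \<sigma>" unfolding se sets_restrict_space using W(1) by auto
  have \<Sigma>W': "(\<Sigma> \<inter> W) \<inter> space \<sigma> \<in> sets \<sigma>"
  proof -
    have "(\<Sigma> \<inter> W) \<inter> space \<sigma> = \<Sigma> \<inter> W" by (auto simp: sp)
    then show ?thesis using \<Sigma>W by simp
  qed
  have spR: "space R = \<Sigma> \<inter> W" by (auto simp: R_def space_restrict_space sp)
  have sR: "sets R = sets (restrict_space borel (\<Sigma> \<inter> W))"
    unfolding R_def sets_restrict_space se image_image by (simp add: Int_ac)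
  have "\<phi> \<in> restrict_space borel D \<rightarrow>\<^sub>M restrict_space borel (\<Sigma> \<inter> W)"
    by (rule measurable_restrict_space2)
      (use W borel_measurable_continuous_on_restrict[OF \<phi>] in \<open>auto simp: space_restrict_space\<close>)
  also have "(restrict_space borel D \<rightarrow>\<^sub>M restrict_space borel (\<Sigma> \<inter> W)) = (restrict_space lborel D \<rightarrow>\<^sub>M R)"
    by (rule measurable_cong_sets) (simp_all add: sR sets_restrict_space)
  finally have \<phi>m: "\<phi> \<in> restrict_space lborel D \<rightarrow>\<^sub>M R" .
  have fm: "f \<in> borel_measurable R"
    using measurable_restrict_space1[OF f, of "\<Sigma> \<inter> W"] measurable_cong_sets[OF sR refl] by blast
  have RN: "sets R = sets N" by (simp add: N_def)
  have "emeasure R A \<le> emeasure N A" if A: "A \<in> sets R" for A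
  proof -
    have AS: "A \<subseteq> \<Sigma> \<inter> W" using sets.sets_into_space[OF A] spR by simp
    have A\<sigma>: "A \<in> sets \<sigma>"
      using A sets_restrict_space_iff[OF \<Sigma>W'] unfolding R_def by blast
    let ?B = "{s\<in>D. \<phi> s \<in> A}"
    have B: "?B = \<phi> -` A \<inter> space (restrict_space lborel D)" by (auto simp: space_restrict_space)
    have Bs: "?B \<in> sets lborel"
    proof -
      have "?B \<in> sets (restrict_space lborel D)" unfolding B by (rule measurable_sets[OF \<phi>m A])
      then show ?thesis using D by (simp add: sets_restrict_space_iff)
    qed
    have "emeasure R A = emeasure \<sigma> A"
      unfolding R_def by (rule emeasure_restrict_space[OF \<Sigma>W' AS])
    also have "\<dots> = (\<integral>\<^sup>+s\<in>?B. ennreal (induced_density G \<Sigma> (\<phi> s) (fd \<phi> s (axis 1 1)) (fd \<phi> s (axis 2 1))) \<partial>lborel)"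
      by (rule em[OF A\<sigma>]) (use AS W in auto)
    also have "\<dots> \<le> (\<integral>\<^sup>+s. ennreal K * indicator ?B s \<partial>lborel)"
      using K by (intro nn_integral_mono) (auto simp: indicator_def intro: ennreal_leI)
    also have "\<dots> = ennreal K * emeasure lborel ?B" by (rule nn_integral_cmult_indicator[OF Bs])
    also have "emeasure lborel ?B = emeasure (restrict_space lborel D) ?B"
      using D by (intro emeasure_restrict_space[symmetric]) auto
    also have "ennreal K * \<dots> = emeasure N A"
      unfolding N_def B using \<phi>m A by (simp add: emeasure_distr)
    finally show ?thesis .
  qed
  then have "R \<le> N" using le_measure[OF RN] by blast
  then have "nn_integral R f \<le> nn_integral N f" by (rule nn_integral_mono_measure[OF RN])
  also have "nn_integral R f = (\<integral>\<^sup>+q\<in>\<Sigma> \<inter> W. f q \<partial>\<sigma>)"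
    unfolding R_def by (rule nn_integral_restrict_space[OF \<Sigma>W'])
  also have "nn_integral N f = ennreal K * (\<integral>\<^sup>+s. f (\<phi> s) \<partial>restrict_space lborel D)"
    unfolding N_def using fm \<phi>m by (simp add: nn_integral_scale_measure nn_integral_distr)
  also have "(\<integral>\<^sup>+s. f (\<phi> s) \<partial>restrict_space lborel D) = (\<integral>\<^sup>+s\<in>D. f (\<phi> s) \<partial>lborel)"
    by (rule nn_integral_restrict_space) (use D in simp)
  finally show ?thesis .
qed

text \<open>The differentials have the same kernel, hence are proportional. Applying this to the
  vector du1(v) \<partial>z - du1(\<partial>z) v gives the cross-multiplied form, which avoids a
  division.\<close>

lemma hor_grad_norm_proportional:
  assumes 1: "local_defining_function \<Sigma> q U\<^sub>1 u\<^sub>1" and 2: "local_defining_function \<Sigma> q U\<^sub>2 u\<^sub>2"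
  shows "\<bar>fd u\<^sub>1 q (axis 3 1)\<bar> * hor_grad_norm u\<^sub>2 q = \<bar>fd u\<^sub>2 q (axis 3 1)\<bar> * hor_grad_norm u\<^sub>1 q"
proof -
  let ?a = "fd u\<^sub>1 q (axis 3 1)" and ?b = "fd u\<^sub>2 q (axis 3 1)"
  have l: "linear (fd u\<^sub>1 q)" "linear (fd u\<^sub>2 q)"
    using 1 2 smooth_on_linear_fd unfolding local_defining_function_def by blast+
  have e: "?a * fd u\<^sub>2 q v = ?b * fd u\<^sub>1 q v" for v
  proof -
    have "fd u\<^sub>1 q (fd u\<^sub>1 q v *\<^sub>R axis 3 1 - ?a *\<^sub>R v) = 0"
      by (simp add: linear_diff[OF l(1)] linear_cmul[OF l(1)])
    from local_defining_function_kernel[OF 1 2 this] show ?thesis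
      by (simp add: linear_diff[OF l(2)] linear_cmul[OF l(2)] mult.commute)
  qed
  have "?a\<^sup>2 * ((vf_deriv heis_X u\<^sub>2 q)\<^sup>2 + (vf_deriv heis_Y u\<^sub>2 q)\<^sup>2)
      = (?a * vf_deriv heis_X u\<^sub>2 q)\<^sup>2 + (?a * vf_deriv heis_Y u\<^sub>2 q)\<^sup>2"
    by (simp add: power_mult_distrib algebra_simps)
  also have "\<dots> = ?b\<^sup>2 * ((vf_deriv heis_X u\<^sub>1 q)\<^sup>2 + (vf_deriv heis_Y u\<^sub>1 q)\<^sup>2)"
    unfolding vf_deriv_def e by (simp add: power_mult_distrib algebra_simps)
  finally have "sqrt (?a\<^sup>2 * ((vf_deriv heis_X u\<^sub>2 q)\<^sup>2 + (vf_deriv heis_Y u\<^sub>2 q)\<^sup>2))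
      = sqrt (?b\<^sup>2 * ((vf_deriv heis_X u\<^sub>1 q)\<^sup>2 + (vf_deriv heis_Y u\<^sub>1 q)\<^sup>2))" by simp
  then show ?thesis by (simp add: real_sqrt_mult hor_grad_norm_def)
qed

text \<open>For nonzero s, \<bar>s\<bar> powr \<alpha> is the (j+1)-th root of \<bar>s\<bar>^j. The
  two hypotheses thus enter with the weights 1/(j+1) and \<alpha>, which add up to 1.\<close>

lemma powr_product_le:
  fixes c s t w :: real
  assumes c: "c > 0" and 1: "c * \<bar>t\<bar> \<le> w" and 2: "c * \<bar>s\<bar> ^ j \<le> w"
  defines "\<alpha> \<equiv> real j / (real j + 1)"
  shows "c * (\<bar>s\<bar> powr \<alpha> * \<bar>t\<bar> powr \<alpha>) \<le> w"
proof (cases "s = 0 \<or> t = 0")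
  case True
  \<comment> \<open>\<open>0 powr \<alpha> = 0\<close>, also for \<open>\<alpha> = 0\<close>\<close>
  then show ?thesis using 1 c by (auto intro: order_trans[of _ "c * \<bar>t\<bar>"])
next
  case False
  define v where "v = w / c"
  have tv: "\<bar>t\<bar> \<le> v" and sv: "\<bar>s\<bar> ^ j \<le> v" using 1 2 c by (simp_all add: v_def field_simps)
  then have v: "v > 0" using False by linarith
  have \<alpha>: "\<alpha> \<ge> 0" "1 / (real j + 1) + \<alpha> = 1" by (simp_all add: \<alpha>_def field_simps)
  have "\<bar>s\<bar> powr \<alpha> = (\<bar>s\<bar> ^ j) powr (1 / (real j + 1))"
    using False by (simp add: \<alpha>_def powr_powr flip: powr_realpow)
  also have "\<dots> \<le> v powr (1 / (real j + 1))" using sv by (intro powr_mono2) auto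
  finally have "\<bar>s\<bar> powr \<alpha> * \<bar>t\<bar> powr \<alpha> \<le> v powr (1 / (real j + 1)) * v powr \<alpha>"
    using tv \<alpha>(1) by (intro mult_mono powr_mono2) auto
  also have "\<dots> = v" using v by (simp flip: powr_add add: \<alpha>(2))
  finally show ?thesis using c by (simp add: v_def field_simps)
qed

text \<open>Carries the comparison to extended reals, where w = 0 is allowed: then x or y is 0 as
  well, and the right side is infinite too.\<close>

lemma inverse_ennreal_le_product:
  fixes c w x y C :: real
  assumes c: "c > 0" and x: "x \<ge> 0" and y: "y \<ge> 0" and w: "c * (x * y) \<le> w" and C: "C > 0"
  shows "ennreal C * (1 / ennreal w) \<le> ennreal (C / c) * (1 / ennreal x * (1 / ennreal y))"
proof (cases "x = 0 \<or> y = 0")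
  case True
  have pos: "0 < 1 / ennreal z" for z
    by (simp add: ennreal_zero_less_divide)
  \<comment> \<open>One factor is infinite, and the other is positive as the reciprocal of a finite
    value.\<close>
  have "1 / ennreal x * (1 / ennreal y) = top"
    using True pos[of x] pos[of y] by (auto simp: ennreal_top_mult ennreal_mult_top)
  then show ?thesis using c C by (simp add: ennreal_mult_top)
next
  case False
  then have xy: "x > 0" "y > 0" using x y by auto
  then have w0: "c * (x * y) > 0" "w > 0" using c w by (auto intro: less_le_trans[OF _ w])
  have "C / w \<le> C / (c * (x * y))" using w0 w C by (intro divide_left_mono) auto
  then have "ennreal (C * (1 / w)) \<le> ennreal (C / c * (1 / x * (1 / y)))"
    by (intro ennreal_leI) (simp add: field_simps)
  moreover have "1 / ennreal z = ennreal (1 / z)" if "z > 0" for z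
    using divide_ennreal[of 1 z] that by simp
  ultimately show ?thesis
    using xy w0 C c by (simp flip: ennreal_mult)
qed

section \<open>The horizontal mean curvature\<close>

lemma has_derivative_vecI:
  fixes f :: "'a::real_normed_vector \<Rightarrow> real^'n"
  assumes "\<And>i. ((\<lambda>x. f x $ i) has_derivative (\<lambda>v. f' v $ i)) (at q)"
  shows "(f has_derivative f') (at q)"
  by (rule has_derivative_componentwise_within[THEN iffD2])
    (use assms in \<open>auto simp: Basis_vec_def inner_axis\<close>)

text \<open>Both \<bar>P\<bar> and \<bar>R\<bar> are at most W, so \<bar>W'\<bar> \<le> 2 M, and the
  quotient rule gives at most (M W + 2 M W) / W^2. The same f' serves all v and M, so the bound can
  be used in several directions.\<close>

lemma has_derivative_normalised_bound:
  fixes P R W :: "'a::real_normed_vector \<Rightarrow> real"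
  assumes P: "(P has_derivative P') (at q)" and R: "(R has_derivative R') (at q)"
    and W_eq: "\<And>x. W x = sqrt ((P x)\<^sup>2 + (R x)\<^sup>2)" and Wq: "W q > 0"
  obtains f' where "((\<lambda>x. P x / W x) has_derivative f') (at q)"
    "\<And>v M. \<bar>P' v\<bar> \<le> M \<Longrightarrow> \<bar>R' v\<bar> \<le> M \<Longrightarrow> \<bar>f' v\<bar> \<le> 3 * M / W q"
proof -
  define w where "w = W q"
  have w: "w = sqrt ((P q)\<^sup>2 + (R q)\<^sup>2)" "w > 0" using W_eq Wq by (simp_all add: w_def)
  define W' where "W' v = (P q * P' v + R q * R' v) / w" for v
  have "((\<lambda>x. (P x)\<^sup>2 + (R x)\<^sup>2) has_derivative (\<lambda>v. 2 * P q * P' v + 2 * R q * R' v)) (at q)"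
    by (auto intro!: derivative_eq_intros P R)
  moreover have "(sqrt has_real_derivative inverse w / 2) (at ((P q)\<^sup>2 + (R q)\<^sup>2))"
    unfolding w(1) by (rule DERIV_real_sqrt) (use w in \<open>simp add: real_sqrt_gt_0_iff\<close>)
  ultimately have "((\<lambda>x. sqrt ((P x)\<^sup>2 + (R x)\<^sup>2)) has_derivative
      (\<lambda>v. inverse w / 2 * (2 * P q * P' v + 2 * R q * R' v))) (at q)"
    unfolding has_field_derivative_def using diff_chain_at by (fastforce simp: o_def)
  also have "(\<lambda>v. inverse w / 2 * (2 * P q * P' v + 2 * R q * R' v)) = W'"
    using w(2) by (auto simp: fun_eq_iff W'_def field_simps)
  finally have W: "(W has_derivative W') (at q)" by (simp only: W_eq[symmetric])
  show thesis
  proof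
    show "((\<lambda>x. P x / W x) has_derivative (\<lambda>v. (P' v * w - P q * W' v) / (w * w))) (at q)"
      unfolding w_def by (rule has_derivative_divide'[OF P W]) (use Wq in simp)
    fix v M assume M: "\<bar>P' v\<bar> \<le> M" "\<bar>R' v\<bar> \<le> M"
    have Pw: "\<bar>P q\<bar> \<le> w" and Rw: "\<bar>R q\<bar> \<le> w" unfolding w(1)
      by (simp_all add: real_le_rsqrt)
    have "\<bar>P q * P' v + R q * R' v\<bar> \<le> w * M + w * M"
      using Pw Rw M w(2) by (intro order_trans[OF abs_triangle_ineq] add_mono) (auto simp: abs_mult intro!: mult_mono)
    then have W'M: "\<bar>W' v\<bar> \<le> 2 * M" using w(2) by (simp add: W'_def field_simps)
    have "\<bar>P' v * w - P q * W' v\<bar> \<le> \<bar>P' v * w\<bar> + \<bar>P q * W' v\<bar>" by (rule abs_triangle_ineq4)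
    also have "\<dots> \<le> M * w + w * (2 * M)"
      using Pw W'M M w(2) by (intro add_mono) (auto simp: abs_mult intro!: mult_mono)
    finally have "\<bar>P' v * w - P q * W' v\<bar> \<le> 3 * M * w" by simp
    then have "\<bar>P' v * w - P q * W' v\<bar> / (w * w) \<le> 3 * M * w / (w * w)"
      using w(2) by (intro divide_right_mono) auto
    then show "\<bar>(P' v * w - P q * W' v) / (w * w)\<bar> \<le> 3 * M / W q" using w(2) by (simp add: abs_divide w_def)
  qed
qed

text \<open>In Cartesian coordinates the normalised gradient is (f, h, (h x - f y) / 2) with f = Xu
  / W and h = Yu / W, and its divergence is Xf + Yh. Each partial derivative costs at most 3 M / W,
  and each coordinate of q at most M.\<close>

lemma hor_mean_curvature_pointwise_bound:
  assumes P: "(vf_deriv heis_X u has_derivative P') (at q)" and R: "(vf_deriv heis_Y u has_derivative R') (at q)"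
    and w: "hor_grad_norm u q > 0"
    and M: "\<And>i. \<bar>P' (axis i 1)\<bar> \<le> M" "\<And>i. \<bar>R' (axis i 1)\<bar> \<le> M" "norm q \<le> M"
  shows "\<bar>hor_mean_curvature u q\<bar> \<le> 3 * M * (2 + M) / hor_grad_norm u q"
proof -
  let ?W = "hor_grad_norm u"
  let ?f = "\<lambda>x. vf_deriv heis_X u x / ?W x" and ?h = "\<lambda>x. vf_deriv heis_Y u x / ?W x"
  obtain f' where f': "(?f has_derivative f') (at q)"
    "\<And>v M. \<bar>P' v\<bar> \<le> M \<Longrightarrow> \<bar>R' v\<bar> \<le> M \<Longrightarrow> \<bar>f' v\<bar> \<le> 3 * M / ?W q"
    using has_derivative_normalised_bound[OF P R hor_grad_norm_def w] by blast
  \<comment> \<open>Xu and Yu exchange their roles, so the sum under the square root is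
    commuted.\<close>
  obtain h' where h': "(?h has_derivative h') (at q)"
    "\<And>v M. \<bar>R' v\<bar> \<le> M \<Longrightarrow> \<bar>P' v\<bar> \<le> M \<Longrightarrow> \<bar>h' v\<bar> \<le> 3 * M / ?W q"
    using has_derivative_normalised_bound[OF R P hor_grad_norm_def[unfolded add.commute[of "(vf_deriv heis_X _ _)\<^sup>2"]] w]
    by blast
  let ?F = "\<lambda>x. hor_grad u x /\<^sub>R ?W x"
  define F' where "F' v = (vector [f' v, h' v,
      1 / 2 * (?h q * v $ 1 + h' v * q $ 1 - (?f q * v $ 2 + f' v * q $ 2))] :: real^3)" for v
  have F_eq: "?F x = vector [?f x, ?h x, 1 / 2 * (?h x * x $ 1 - ?f x * x $ 2)]" for x
    by (simp add: vec_eq_iff forall_3 hor_grad_def heis_X_def heis_Y_def field_simps)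
  have c: "((\<lambda>x. x $ i) has_derivative (\<lambda>v. v $ i)) (at q)" for i :: 3
    by (rule bounded_linear_imp_has_derivative[OF bounded_linear_vec_nth])
  note 3 = has_derivative_mult_right[OF has_derivative_diff[OF has_derivative_mult[OF h'(1) c[of 1]]
        has_derivative_mult[OF f'(1) c[of 2]]], of "1 / 2"]
  have "(?F has_derivative F') (at q)"
  proof (rule has_derivative_vecI)
    fix i :: 3
    show "((\<lambda>x. ?F x $ i) has_derivative (\<lambda>v. F' v $ i)) (at q)"
      unfolding F_eq F'_def using exhaust_3[of i] f'(1) h'(1) 3 by (elim disjE) (simp_all only: vector_3)
  qed
  then have "divergence ?F q = (\<Sum>i\<in>UNIV. F' (axis i 1) $ i)"
    by (simp add: divergence_def frechet_derivative_eqI)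
  also have "\<dots> = f' (axis 1 1) + h' (axis 2 1) + (h' (axis 3 1) * q $ 1 - f' (axis 3 1) * q $ 2) / 2"
    by (simp add: sum_3 F'_def axis_def)
  finally have H: "hor_mean_curvature u q
      = - (f' (axis 1 1) + h' (axis 2 1) + (h' (axis 3 1) * q $ 1 - f' (axis 3 1) * q $ 2) / 2)"
    by (simp add: hor_mean_curvature_def)
  define b where "b = 3 * M / ?W q"
  have b: "\<bar>f' (axis i 1)\<bar> \<le> b" "\<bar>h' (axis i 1)\<bar> \<le> b" for i
    unfolding b_def using f'(2) h'(2) M by blast+
  have q: "\<bar>q $ i\<bar> \<le> M" for i using component_le_norm_cart order_trans M(3) by blast
  have hf: "\<bar>h' (axis 3 1) * q $ 1\<bar> \<le> b * M" "\<bar>f' (axis 3 1) * q $ 2\<bar> \<le> b * M"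
    unfolding abs_mult by (intro mult_mono b q; use b[of 3] in linarith)+
  have "\<bar>hor_mean_curvature u q\<bar> \<le> b + b + b * M"
  proof -
    have "\<bar>- (s + t + (x - y) / 2)\<bar> \<le> b + b + c"
      if "\<bar>x\<bar> \<le> c" "\<bar>y\<bar> \<le> c" "\<bar>s\<bar> \<le> b" "\<bar>t\<bar> \<le> b" for s t x y c :: real
      using that by argo
    from this[OF hf b(1)[of 1] b(2)[of 2]] show ?thesis unfolding H .
  qed
  also have "\<dots> = 3 * M * (2 + M) / ?W q" by (simp add: b_def algebra_simps add_divide_distrib)
  finally show ?thesis .
qed

text \<open>On a compact ball the derivatives of Xu and Yu and the points themselves are bounded,
  which makes the pointwise bound uniform.\<close>

lemma hor_mean_curvature_local_bound:
  assumes u: "smooth_on U u" and p: "p \<in> U"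
  obtains Q C where "open Q" "p \<in> Q" "Q \<subseteq> U" "C > 0"
    "\<And>q. q \<in> Q \<Longrightarrow> hor_grad_norm u q > 0 \<Longrightarrow> \<bar>hor_mean_curvature u q\<bar> \<le> C / hor_grad_norm u q"
proof -
  have X: "smooth_on U (vf_deriv heis_X u)" and Y: "smooth_on U (vf_deriv heis_Y u)"
    unfolding heis_X_eq heis_Y_eq by (rule smooth_on_vf_deriv_field_N[OF u])+
  have U: "open U" using u by (simp add: smooth_on_def)
  obtain \<rho> where \<rho>: "\<rho> > 0" "cball p \<rho> \<subseteq> U" using U p open_contains_cball by blast
  have b: "\<exists>B>0. \<forall>q\<in>cball p \<rho>. norm (f q) \<le> B" if f: "continuous_on U f" for f :: "real^3 \<Rightarrow> real"
  proof -
    obtain B where "B > 0" "\<And>q. q \<in> cball p \<rho> \<Longrightarrow> norm (f q) \<le> B"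
      using continuous_on_compact_bound[OF f compact_cball \<rho>(2)] by blast
    then show ?thesis by blast
  qed
  have "\<exists>B>0. \<forall>q\<in>cball p \<rho>. norm (fd (vf_deriv heis_X u) q (axis i 1)) \<le> B" for i
    by (rule b[OF smooth_on_continuous_on[OF smooth_on_frechet_derivative[OF X]]])
  then obtain BX where BX: "\<And>i q. q \<in> cball p \<rho> \<Longrightarrow> norm (fd (vf_deriv heis_X u) q (axis i 1)) \<le> BX i"
    by metis
  have "\<exists>B>0. \<forall>q\<in>cball p \<rho>. norm (fd (vf_deriv heis_Y u) q (axis i 1)) \<le> B" for i
    by (rule b[OF smooth_on_continuous_on[OF smooth_on_frechet_derivative[OF Y]]])
  then obtain BY where BY: "\<And>i q. q \<in> cball p \<rho> \<Longrightarrow> norm (fd (vf_deriv heis_Y u) q (axis i 1)) \<le> BY i"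
    by metis
  \<comment> \<open>Sums instead of maxima: one constant dominates all six bounds and the norm of
    every point of the ball.\<close>
  define M where "M = (\<Sum>i\<in>UNIV. \<bar>BX i\<bar>) + (\<Sum>i\<in>UNIV. \<bar>BY i\<bar>) + (norm p + \<rho>)"
  have nn: "0 \<le> (\<Sum>i\<in>UNIV. \<bar>BX i\<bar>)" "0 \<le> (\<Sum>i\<in>UNIV. \<bar>BY i\<bar>)" by (simp_all add: sum_nonneg)
  have le: "\<bar>BX i\<bar> \<le> (\<Sum>i\<in>UNIV. \<bar>BX i\<bar>)" "\<bar>BY i\<bar> \<le> (\<Sum>i\<in>UNIV. \<bar>BY i\<bar>)" for i
    by (rule member_le_sum; simp)+
  have M: "M > 0" unfolding M_def using nn \<rho>(1) norm_ge_zero[of p] by linarith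
  show thesis
  proof
    show "open (ball p \<rho>)" "p \<in> ball p \<rho>" "ball p \<rho> \<subseteq> U" using \<rho> by auto
    show "3 * M * (2 + M) > 0" using M by simp
    fix q assume q: "q \<in> ball p \<rho>" and w: "hor_grad_norm u q > 0"
    then have qc: "q \<in> cball p \<rho>" and qU: "q \<in> U" using \<rho> by auto
    show "\<bar>hor_mean_curvature u q\<bar> \<le> 3 * M * (2 + M) / hor_grad_norm u q"
    proof (rule hor_mean_curvature_pointwise_bound[OF smooth_on_has_derivative[OF X qU]
          smooth_on_has_derivative[OF Y qU] w])
      fix i
      show "\<bar>fd (vf_deriv heis_X u) q (axis i 1)\<bar> \<le> M"
        using BX[OF qc, of i] le(1)[of i] nn \<rho>(1) norm_ge_zero[of p] unfolding M_def real_norm_def by linarith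
      show "\<bar>fd (vf_deriv heis_Y u) q (axis i 1)\<bar> \<le> M"
        using BY[OF qc, of i] le(2)[of i] nn \<rho>(1) norm_ge_zero[of p] unfolding M_def real_norm_def by linarith
      have "norm q \<le> norm p + \<rho>"
        using q norm_triangle_ineq2[of q p] by (simp add: dist_norm norm_minus_commute)
      then show "norm q \<le> M" using nn unfolding M_def by linarith
    qed
  qed
qed

section \<open>Local integrability\<close>

lemma nn_integral_inverse_box_finite:
  fixes w :: "real^2 \<Rightarrow> real"
  assumes D: "D = {y :: real^2. \<bar>y $ 1 - a\<bar> < r \<and> \<bar>y $ 2\<bar> < r}"
    and c: "c > 0" and C: "C > 0"
    and 1: "\<And>y. y \<in> D \<Longrightarrow> c * \<bar>y $ 2\<bar> \<le> w y"
    and 2: "\<And>y. y \<in> D \<Longrightarrow> c * \<bar>y $ 1 - a\<bar> ^ j \<le> w y"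
  shows "(\<integral>\<^sup>+y\<in>D. ennreal C * (1 / ennreal (w y)) \<partial>lborel) < \<infinity>"
proof -
  define \<alpha> where "\<alpha> = real j / (real j + 1)"
  have \<alpha>: "0 \<le> \<alpha>" "\<alpha> < 1" by (simp_all add: \<alpha>_def field_simps)
  \<comment> \<open>The indicator is part of each factor, so that the box splits along with the
    integrand and the integral becomes a product.\<close>
  define g where "g b x = 1 / ennreal (\<bar>x - b\<bar> powr \<alpha>) * indicator {b - r<..<b + r} x" for b x :: real
  have [measurable]: "g b \<in> borel_measurable borel" for b unfolding g_def by measurable
  have "(\<integral>\<^sup>+y\<in>D. ennreal C * (1 / ennreal (w y)) \<partial>lborel)
      \<le> (\<integral>\<^sup>+y. ennreal (C / c) * (g a (y $ 1) * g 0 (y $ 2)) \<partial>(lborel :: (real^2) measure))"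
  proof (rule nn_integral_mono)
    fix y :: "real^2"
    show "ennreal C * (1 / ennreal (w y)) * indicator D y
        \<le> ennreal (C / c) * (g a (y $ 1) * g 0 (y $ 2))"
    proof (cases "y \<in> D")
      case True
      have "c * (\<bar>y $ 1 - a\<bar> powr \<alpha> * \<bar>y $ 2\<bar> powr \<alpha>) \<le> w y"
        unfolding \<alpha>_def by (rule powr_product_le[OF c 1[OF True] 2[OF True]])
      from inverse_ennreal_le_product[OF c _ _ this C]
      have "ennreal C * (1 / ennreal (w y))
        \<le> ennreal (C / c) * (1 / ennreal (\<bar>y $ 1 - a\<bar> powr \<alpha>) * (1 / ennreal (\<bar>y $ 2\<bar> powr \<alpha>)))"
        by simp
      then show ?thesis using True by (simp add: g_def D indicator_def abs_less_iff)
    qed simp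
  qed
  also have "\<dots> = ennreal (C / c) * (\<integral>\<^sup>+y. g a (y $ 1) * g 0 (y $ 2) \<partial>(lborel :: (real^2) measure))"
    by (rule nn_integral_cmult) measurable
  also have "\<dots> = ennreal (C / c) * ((\<integral>\<^sup>+x. g a x \<partial>lborel) * (\<integral>\<^sup>+x. g 0 x \<partial>lborel))"
    by (subst nn_integral_real2_prod) auto
  also have "\<dots> < \<infinity>"
    using nn_integral_inverse_powr_finite[OF \<alpha>, of a r] nn_integral_inverse_powr_finite[OF \<alpha>, of 0 r]
    unfolding g_def by (auto simp: ennreal_mult_less_top)
  finally show ?thesis .
qed

text \<open>G-unit vectors have bounded Euclidean length over the bounded set \<open>W\<close>, so
  the density is a determinant of three bounded vectors.\<close>

lemma chart_induced_density_bound: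
  assumes G: "riemannian_metric G" and ldf: "local_defining_function \<Sigma> p U u"
    and W: "bounded W" "W \<subseteq> U" "\<phi> ` D \<subseteq> \<Sigma> \<inter> W"
    and B: "\<And>y. y \<in> D \<Longrightarrow> norm (fd \<phi> y (axis 1 1)) \<le> B" "\<And>y. y \<in> D \<Longrightarrow> norm (fd \<phi> y (axis 2 1)) \<le> B"
  obtains K where
    "\<And>y. y \<in> D \<Longrightarrow> induced_density G \<Sigma> (\<phi> y) (fd \<phi> y (axis 1 1)) (fd \<phi> y (axis 2 1)) \<le> K"
proof -
  have "compact (closure W)" using W(1) by (simp add: compact_closure)
  then obtain A where A: "A > 0" "\<And>q v. q \<in> closure W \<Longrightarrow> G q v v = 1 \<Longrightarrow> norm v \<le> A"
    using riemannian_metric_unit_bound[OF G] by blast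
  show thesis
  proof
    fix y assume y: "y \<in> D"
    have q: "\<phi> y \<in> \<Sigma> \<inter> U" "\<phi> y \<in> closure W"
      using y W(2,3) closure_subset by blast+
    have "norm (unit_normal G \<Sigma> (\<phi> y)) \<le> A"
      using A(2)[OF q(2) unit_normal_unit[OF G local_defining_function_move[OF ldf q(1)]]] .
    then show "induced_density G \<Sigma> (\<phi> y) (fd \<phi> y (axis 1 1)) (fd \<phi> y (axis 2 1)) \<le> 6 * (A * B * B)"
      unfolding induced_density_def by (rule abs_det_3_le[OF _ B[OF y]])
  qed
qed

lemma continuous_on_hor_grad_norm:
  assumes "smooth_on U u" shows "continuous_on U (hor_grad_norm u)"
  unfolding hor_grad_norm_def[abs_def] heis_X_eq heis_Y_eq
  by (intro continuous_intros smooth_on_continuous_on smooth_on_vf_deriv_field_N assms)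

text \<open>Carries the estimate from the defining function that witnesses mild degeneracy to the
  given one. The vertical derivative of \<open>u\<^sub>1\<close> is nonzero at p, so the ratio of
  the two norms is controlled near p.\<close>

lemma hor_grad_norm_comparable:
  assumes p: "p \<in> characteristic_set \<Sigma>"
    and 1: "local_defining_function \<Sigma> p U\<^sub>1 u\<^sub>1" and 2: "local_defining_function \<Sigma> p U\<^sub>2 u\<^sub>2"
  obtains Q c where "open Q" "p \<in> Q" "Q \<subseteq> U\<^sub>1 \<inter> U\<^sub>2" "c > 0"
    "\<And>q. q \<in> \<Sigma> \<inter> Q \<Longrightarrow> c * hor_grad_norm u\<^sub>2 q \<le> hor_grad_norm u\<^sub>1 q"
proof -
  let ?a = "\<lambda>q. fd u\<^sub>1 q (axis 3 1)" and ?b = "\<lambda>q. fd u\<^sub>2 q (axis 3 1)"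
  have s: "smooth_on U\<^sub>1 u\<^sub>1" "smooth_on U\<^sub>2 u\<^sub>2" and o: "open U\<^sub>1" "open U\<^sub>2" and pU: "p \<in> U\<^sub>1" "p \<in> U\<^sub>2"
    using 1 2 unfolding local_defining_function_def by blast+
  \<comment> \<open>By continuity, half the value at p persists nearby as a lower bound and the
    value at p plus one as an upper bound.\<close>
  define A where "A = \<bar>?a p\<bar> / 2"
  define B where "B = \<bar>?b p\<bar> + 1"
  have A: "A > 0" using characteristic_vertical_deriv_nonzero[OF 1 p] by (simp add: A_def)
  have B: "B > 0" by (simp add: B_def add_nonneg_pos)
  define Q where "Q = (U\<^sub>1 \<inter> (\<lambda>q. \<bar>?a q\<bar>) -` {A<..}) \<inter> (U\<^sub>2 \<inter> (\<lambda>q. \<bar>?b q\<bar>) -` {..<B})"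
  show thesis
  proof
    show "open Q" unfolding Q_def
      by (intro open_Int continuous_open_preimage o continuous_on_rabs open_greaterThan open_lessThan
          smooth_on_continuous_on[OF smooth_on_frechet_derivative[OF s(1)]]
          smooth_on_continuous_on[OF smooth_on_frechet_derivative[OF s(2)]])
    show "p \<in> Q" using A pU by (simp add: Q_def A_def B_def)
    show "Q \<subseteq> U\<^sub>1 \<inter> U\<^sub>2" by (auto simp: Q_def)
    show "A / B > 0" using A B by simp
    fix q assume q: "q \<in> \<Sigma> \<inter> Q"
    then have ab: "A \<le> \<bar>?a q\<bar>" "\<bar>?b q\<bar> \<le> B" by (auto simp: Q_def)
    have "q \<in> \<Sigma> \<inter> U\<^sub>1" "q \<in> \<Sigma> \<inter> U\<^sub>2" using q by (auto simp: Q_def)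
    then have e: "\<bar>?a q\<bar> * hor_grad_norm u\<^sub>2 q = \<bar>?b q\<bar> * hor_grad_norm u\<^sub>1 q"
      using hor_grad_norm_proportional local_defining_function_move[OF 1] local_defining_function_move[OF 2] by blast
    have nn: "hor_grad_norm u\<^sub>1 q \<ge> 0" "hor_grad_norm u\<^sub>2 q \<ge> 0" by (simp_all add: hor_grad_norm_def)
    have "A * hor_grad_norm u\<^sub>2 q \<le> \<bar>?a q\<bar> * hor_grad_norm u\<^sub>2 q" using ab nn by (intro mult_right_mono)
    also have "\<dots> \<le> B * hor_grad_norm u\<^sub>1 q" unfolding e using ab nn by (intro mult_right_mono)
    finally show "A / B * hor_grad_norm u\<^sub>2 q \<le> hor_grad_norm u\<^sub>1 q" using B by (simp add: field_simps)
  qed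
qed

theorem theorem4p5:
  fixes \<Sigma> :: "(real^3) set" and p :: "real^3"
    and U\<^sub>0 :: "(real^3) set" and u :: "real^3 \<Rightarrow> real"
    and G :: "real^3 \<Rightarrow> real^3 \<Rightarrow> real^3 \<Rightarrow> real" and \<sigma> :: "(real^3) measure"
  assumes "embedded_surface \<Sigma>"
    and "p isolated_in characteristic_set \<Sigma>"
    and "mildly_degenerate \<Sigma> p"
    and "local_defining_function \<Sigma> p U\<^sub>0 u"
    and "riemannian_metric G" and "extends_heis_metric G"
    and "riemannian_induced_measure G \<Sigma> \<sigma>"
  shows "(\<exists>U. open U \<and> p \<in> U \<and> U \<subseteq> U\<^sub>0 \<and>
            (\<integral>\<^sup>+q\<in>\<Sigma> \<inter> U. 1 / ennreal (hor_grad_norm u q) \<partial>\<sigma>) < \<infinity>) \<and>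
         (\<exists>U. open U \<and> p \<in> U \<and> U \<subseteq> U\<^sub>0 \<and>
            (\<integral>\<^sup>+q\<in>\<Sigma> \<inter> U - characteristic_set \<Sigma>. ennreal \<bar>hor_mean_curvature u q\<bar> \<partial>\<sigma>) < \<infinity>)"
proof -
  note ldf = assms(4)
  obtain U u' n \<epsilon> \<gamma> k where ldf': "local_defining_function \<Sigma> p U u'" and n: "norm n = 1"
    and hess: "\<And>V. hor_Hess u' p n V = 0"
    and \<gamma>: "regular_parametrization_near (critical_curve \<Sigma> n) p \<epsilon> \<gamma>"
    and k: "(deriv ^^ k) (\<lambda>s. vf_deriv (field_T n) u' (\<gamma> s)) 0 \<noteq> 0"
    using assms(3) unfolding mildly_degenerate_def by blast
  have p: "p \<in> characteristic_set \<Sigma>" using assms(3) by (simp add: mildly_degenerate_def degenerate_def)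
  have u: "smooth_on U\<^sub>0 u" and pU: "p \<in> U\<^sub>0" using ldf unfolding local_defining_function_def by blast+
  obtain Q\<^sub>1 c\<^sub>1 where Q1: "open Q\<^sub>1" "p \<in> Q\<^sub>1" "Q\<^sub>1 \<subseteq> U\<^sub>0 \<inter> U" and c1: "c\<^sub>1 > 0"
    "\<And>q. q \<in> \<Sigma> \<inter> Q\<^sub>1 \<Longrightarrow> c\<^sub>1 * hor_grad_norm u' q \<le> hor_grad_norm u q"
    using hor_grad_norm_comparable[OF p ldf ldf'] by blast
  obtain Q\<^sub>2 C where Q2: "open Q\<^sub>2" "p \<in> Q\<^sub>2" "Q\<^sub>2 \<subseteq> U\<^sub>0" and C: "C > 0"
    "\<And>q. q \<in> Q\<^sub>2 \<Longrightarrow> hor_grad_norm u q > 0 \<Longrightarrow> \<bar>hor_mean_curvature u q\<bar> \<le> C / hor_grad_norm u q"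
    using hor_mean_curvature_local_bound[OF u pU] by blast
  \<comment> \<open>The unit ball keeps the chart region bounded, as the bound on the density
    requires.\<close>
  have Q: "open (Q\<^sub>1 \<inter> Q\<^sub>2 \<inter> ball p 1)" "p \<in> Q\<^sub>1 \<inter> Q\<^sub>2 \<inter> ball p 1" using Q1 Q2 by auto
  obtain W D \<phi> a r c j B where W: "open W" "p \<in> W" "W \<subseteq> Q\<^sub>1 \<inter> Q\<^sub>2 \<inter> ball p 1 \<inter> U"
    and D: "D = {y :: real^2. \<bar>y $ 1 - a\<bar> < r \<and> \<bar>y $ 2\<bar> < r}"
    and chart: "surface_chart \<Sigma> D \<phi>" and \<phi>D: "\<phi> ` D = \<Sigma> \<inter> W" and c: "c > 0"
    and B: "\<And>y. y \<in> D \<Longrightarrow> norm (fd \<phi> y (axis 1 1)) \<le> B" "\<And>y. y \<in> D \<Longrightarrow> norm (fd \<phi> y (axis 2 1)) \<le> B"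
    and lower: "\<And>y. y \<in> D \<Longrightarrow> \<bar>y $ 2\<bar> \<le> hor_grad_norm u' (\<phi> y)"
      "\<And>y. y \<in> D \<Longrightarrow> c * \<bar>y $ 1 - a\<bar> ^ j \<le> hor_grad_norm u' (\<phi> y)"
    by (rule straightened_chart[OF ldf' p n hess \<gamma> k Q]) (rule that)
  have WU: "W \<subseteq> U\<^sub>0" and WQ: "W \<subseteq> Q\<^sub>1" "W \<subseteq> Q\<^sub>2" "W \<subseteq> U" using W(3) Q1 by auto
  have "bounded W" using bounded_subset[OF bounded_ball] W(3) by blast
  then obtain K where K:
    "\<And>y. y \<in> D \<Longrightarrow> induced_density G \<Sigma> (\<phi> y) (fd \<phi> y (axis 1 1)) (fd \<phi> y (axis 2 1)) \<le> K"
    using chart_induced_density_bound[OF assms(5) ldf' _ WQ(3) equalityD1[OF \<phi>D] B] by blast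
  let ?w = "hor_grad_norm u"
  \<comment> \<open>A single constant for both lower bounds, after the passage from u' to u.\<close>
  define c' where "c' = min c\<^sub>1 (c\<^sub>1 * c)"
  have c': "c' > 0" "c' \<le> c\<^sub>1" "c' \<le> c\<^sub>1 * c" using c c1 by (auto simp: c'_def)
  have lower': "c' * \<bar>y $ 2\<bar> \<le> ?w (\<phi> y)" "c' * \<bar>y $ 1 - a\<bar> ^ j \<le> ?w (\<phi> y)" if y: "y \<in> D" for y
  proof -
    have "\<phi> y \<in> \<Sigma> \<inter> Q\<^sub>1" using y \<phi>D WQ by blast
    note c1' = c1(2)[OF this]
    have "c' * \<bar>y $ 2\<bar> \<le> c\<^sub>1 * \<bar>y $ 2\<bar>" using c' by (intro mult_right_mono) auto
    also have "\<dots> \<le> c\<^sub>1 * hor_grad_norm u' (\<phi> y)" using lower(1)[OF y] c1 by (intro mult_left_mono) auto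
    finally show "c' * \<bar>y $ 2\<bar> \<le> ?w (\<phi> y)" using c1' by linarith
    have "c' * \<bar>y $ 1 - a\<bar> ^ j \<le> c\<^sub>1 * c * \<bar>y $ 1 - a\<bar> ^ j" using c' by (intro mult_right_mono) auto
    also have "\<dots> \<le> c\<^sub>1 * hor_grad_norm u' (\<phi> y)"
      using mult_left_mono[OF lower(2)[OF y], of c\<^sub>1] c1 by (simp add: mult.assoc)
    finally show "c' * \<bar>y $ 1 - a\<bar> ^ j \<le> ?w (\<phi> y)" using c1' by linarith
  qed
  \<comment> \<open>The factor C' is 1 for the integral of 1/W and the constant of the curvature
    bound for the second claim.\<close>
  have fin: "(\<integral>\<^sup>+q\<in>\<Sigma> \<inter> W. ennreal C' * (1 / ennreal (?w q)) \<partial>\<sigma>) < \<infinity>" if C': "C' > 0" for C' :: real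
  proof -
    \<comment> \<open>The cut-off outside \<open>W\<close>, where u is not controlled, gives a Borel
      function on the whole space.\<close>
    define w where "w q = (if q \<in> W then ?w q else 0)" for q
    have "continuous_on W ?w"
      using continuous_on_subset[OF continuous_on_hor_grad_norm[OF u] WU] .
    then have [measurable]: "w \<in> borel_measurable borel"
      unfolding w_def[abs_def] using W(1) by (intro borel_measurable_continuous_on_if) auto
    have "(\<integral>\<^sup>+q\<in>\<Sigma> \<inter> W. ennreal C' * (1 / ennreal (?w q)) \<partial>\<sigma>)
        = (\<integral>\<^sup>+q\<in>\<Sigma> \<inter> W. ennreal C' * (1 / ennreal (w q)) \<partial>\<sigma>)"
      by (rule nn_integral_cong) (auto simp: w_def indicator_def)
    also have "\<dots> \<le> ennreal K * (\<integral>\<^sup>+y\<in>D. ennreal C' * (1 / ennreal (w (\<phi> y))) \<partial>lborel)"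
      by (rule nn_integral_induced_measure_le[OF assms(7) chart K W(1) \<phi>D]) measurable
    also have "\<dots> < \<infinity>"
    proof -
      have "w (\<phi> y) = ?w (\<phi> y)" if "y \<in> D" for y using that \<phi>D by (auto simp: w_def)
      then have "(\<integral>\<^sup>+y\<in>D. ennreal C' * (1 / ennreal (w (\<phi> y))) \<partial>lborel) < \<infinity>"
        by (intro nn_integral_inverse_box_finite[OF D c'(1) C', of _ j]) (simp_all add: lower')
      then show ?thesis by (simp add: ennreal_mult_less_top)
    qed
    finally show ?thesis .
  qed
  have "(\<integral>\<^sup>+q\<in>\<Sigma> \<inter> W. 1 / ennreal (?w q) \<partial>\<sigma>) < \<infinity>" using fin[of 1] by simp
  moreover have "(\<integral>\<^sup>+q\<in>\<Sigma> \<inter> W - characteristic_set \<Sigma>. ennreal \<bar>hor_mean_curvature u q\<bar> \<partial>\<sigma>)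
      \<le> (\<integral>\<^sup>+q\<in>\<Sigma> \<inter> W. ennreal C * (1 / ennreal (?w q)) \<partial>\<sigma>)"
  proof (rule nn_integral_mono)
    fix q
    have "ennreal \<bar>hor_mean_curvature u q\<bar> \<le> ennreal C * (1 / ennreal (?w q))" if q: "q \<in> W"
    proof (cases "?w q = 0")
      \<comment> \<open>Here the majorant is infinite.\<close>
      case True
      then show ?thesis using C by (simp add: ennreal_mult_top)
    next
      case False
      then have w: "?w q > 0" by (simp add: hor_grad_norm_def order_less_le)
      have "ennreal \<bar>hor_mean_curvature u q\<bar> \<le> ennreal (C * (1 / ?w q))"
        using C(2)[of q] q WQ w by (intro ennreal_leI) auto
      also have "\<dots> = ennreal C * (1 / ennreal (?w q))"
        using divide_ennreal[of 1 "?w q"] w C(1) by (subst ennreal_mult) auto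
      finally show ?thesis .
    qed
    then show "ennreal \<bar>hor_mean_curvature u q\<bar> * indicator (\<Sigma> \<inter> W - characteristic_set \<Sigma>) q
        \<le> ennreal C * (1 / ennreal (?w q)) * indicator (\<Sigma> \<inter> W) q"
      by (auto simp: indicator_def)
  qed
  ultimately show ?thesis using fin[OF C(1)] W(1,2) WU le_less_trans by blast
qed

end
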